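(* Let $D$ satisfy (H1), (H2), (H3) as listed in the context, and assume additionally that $$D(\mathbf{u}(\mathbf{x},t)+\mathbf{C})=D(\mathbf{u}(\mathbf{x},t))$$ for all $(\mathbf{x},t)\in Q_T$, all $\mathbf{u}$ with $\mathbf{u}(\cdot,t)\in X_1$ and all $\mathbf{C}=(C_1,C_2)^T\in\mathbb{R}^2$. Then, for every initial datum $\mathbf{u}_0\in X_1$ and every $\mathbf{C}\in\mathbb{R}^2$, $$T_t(\mathbf{0})=\mathbf{0},\qquad T_t(\mathbf{u}_0+\mathbf{C})=T_t(\mathbf{u}_0)+\mathbf{C},\qquad t\ge0.$$
   Context: $\Omega\subset\mathbb{R}^2$ is a bounded (typically rectangular) domain with boundary $\partial\Omega$ and outward normal $n$; $T>0$, $Q_T=\Omega\times(0,T]$, $\overline{Q_T}=\overline\Omega\times[0,T]$. $X_k=H^k(\Omega)\times H^k(\Omega)$, with $H^0(\Omega)=L^2(\Omega)$. $J\mathbf{u}$ is the Jacobian matrix of $\mathbf{u}=(u,v)^T$ with respect to the space variables (rows $\nabla u$, $\nabla v$). The cross-diffusion matrix $D=(D_{ij})_{i,j=1,2}$ assigns to $\mathbf{u}:\overline{Q_T}\to\mathbb{R}^2$ the matrix-valued function $D(\mathbf{u})(\mathbf{x},t)=D(\mathbf{u}(\mathbf{x},t))\in M_{2\times2}(\mathbb{R})$. The hypotheses on $D$ are: (H1) there is $\alpha>0$ such that for each $\mathbf{u}:\overline{Q_T}\to\mathbb{R}^2$, $\xi^TD(\mathbf{u}(\mathbf{x},t))\xi\ge\alpha|\xi|^2$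 for all $\xi\in\mathbb{R}^2$, $(\mathbf{x},t)\in\overline{Q_T}$; (H2) there is $L>0$ such that for all $\mathbf{u},\mathbf{v}:\overline{Q_T}\to\mathbb{R}^2$, $(\mathbf{x},t)\in\overline{Q_T}$, $i,j=1,2$, $|D_{ij}(\mathbf{v}(\mathbf{x},t))-D_{ij}(\mathbf{u}(\mathbf{x},t))|\le L|\mathbf{v}(\mathbf{x},t)-\mathbf{u}(\mathbf{x},t)|$; (H3) there is $M>0$ such that for each $\mathbf{u}:\overline{Q_T}\to\mathbb{R}^2$, $|D_{ij}(\mathbf{u}(\mathbf{x},t))|\le M$ for all $(\mathbf{x},t)\in\overline{Q_T}$, $i,j=1,2$. Problem (P), for $\mathbf{u}=(u,v)^T$: $$\partial_t u=\mathrm{div}(D_{11}(\mathbf{u})\nabla u+D_{12}(\mathbf{u})\nabla v),\quad \partial_t v=\mathrm{div}(D_{21}(\mathbf{u})\nabla u+D_{22}(\mathbf{u})\nabla v)\quad\text{in }Q_T,$$ with $u(\mathbf{x},0)=u_0(\mathbf{x})$, $v(\mathbf{x},0)=v_0(\mathbf{x})$ for $\mathbf{x}\in\Omega$, and on $\partial\Omega\times[0,T]$: $\langle D_{11}(\mathbf{u})\nabla u+D_{12}(\mathbf{u})\nabla v,n\rangle=0$, $\langle D_{21}(\mathbf{u})\nabla u+D_{22}(\mathbf{u})\nabla v,n\rangle=0$. A weak solution of (P) is $\mathbf{u}=(u,v)^T\in C(0,T,X_0)\cap L^2(0,T,X_1)$, with $\mathbf{u}(0)=\mathbf{u}_0$,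 such that for any $t\in(0,T]$ $$\int_\Omega\left((\partial_tu)w_1+(\partial_tv)w_2\right)d\Omega+\int_\Omega\mathrm{tr}\left((J\mathbf{w})^TD(\mathbf{u})(J\mathbf{u})\right)d\Omega=0\quad\text{for all }\mathbf{w}=(w_1,w_2)^T\in X_1,$$ where $\mathrm{tr}$ is the trace and the integral of a product of an element of $(H^1(\Omega))'$ and one of $H^1(\Omega)$ is understood as the duality pairing. Under (H1)-(H3), for $\mathbf{u}_0\in X_1$ the weak solution exists and is unique for every $T>0$. Scale-space operator: for $t\ge0$, $T_t(\mathbf{u}_0):=\mathbf{u}(t)=\mathbf{u}(\cdot,t)$, where $\mathbf{u}$ is the unique weak solution of (P) with initial data $\mathbf{u}_0$ ($T$ being arbitrary). A vector $\mathbf{C}\in\mathbb{R}^2$ is identified with the constant function on $\Omega$. *)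

theory Defs
  imports "HOL-Analysis.Analysis"
begin

text \<open>
  Elements of function spaces are represented by ordinary functions, and only their restrictions
  to \<open>\<Omega>\<close>, up to null sets, matter. A space-time field \<open>u\<close> is written \<open>u t x\<close>
  for \<open>\<bold>u(x,t)\<close>, so that \<open>u t\<close> is the time slice \<open>\<bold>u(\<cdot>,t)\<close>.
\<close>

type_synonym field2 = "real^2 \<Rightarrow> real^2"
type_synonym jacobian2 = "real^2 \<Rightarrow> real^2^2"

definition bounded_domain :: "(real^2) set \<Rightarrow> bool" where
  "bounded_domain \<Omega> \<longleftrightarrow> open \<Omega> \<and> connected \<Omega> \<and> bounded \<Omega> \<and> \<Omega> \<noteq> {}"


subsection \<open>Test functions\<close>

primrec C_diff :: "nat \<Rightarrow> ('a::euclidean_space \<Rightarrow> real) \<Rightarrow> bool" where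
  "C_diff 0 \<phi> \<longleftrightarrow> continuous_on UNIV \<phi>"
| "C_diff (Suc n) \<phi> \<longleftrightarrow> (\<forall>x. \<phi> differentiable (at x)) \<and>
     (\<forall>h. C_diff n (\<lambda>x. frechet_derivative \<phi> (at x) h))"

text \<open>\<open>C\<^sub>c\<^sup>\<infinity>(S)\<close>, each function being extended by zero outside \<open>S\<close>.\<close>

definition test_functions :: "'a::euclidean_space set \<Rightarrow> ('a \<Rightarrow> real) set" where
  "test_functions S = {\<phi>. (\<forall>n. C_diff n \<phi>) \<and>
     compact (closure {x. \<phi> x \<noteq> 0}) \<and> closure {x. \<phi> x \<noteq> 0} \<subseteq> S}"


subsection \<open>The spaces \<open>X\<^sub>0 = L\<^sup>2 \<times> L\<^sup>2\<close> and \<open>X\<^sub>1 = H\<^sup>1 \<times> H\<^sup>1\<close>\<close>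

definition L2 :: "(real^2) set \<Rightarrow> (real^2 \<Rightarrow> 'b::euclidean_space) set" where
  "L2 \<Omega> = {f. f \<in> borel_measurable (lebesgue_on \<Omega>) \<and>
     integrable (lebesgue_on \<Omega>) (\<lambda>x. (norm (f x))\<^sup>2)}"

definition L2_norm :: "(real^2) set \<Rightarrow> (real^2 \<Rightarrow> 'b::euclidean_space) \<Rightarrow> real" where
  "L2_norm \<Omega> f = sqrt (\<integral>x. (norm (f x))\<^sup>2 \<partial>lebesgue_on \<Omega>)"

definition has_weak_gradient ::
    "(real^2) set \<Rightarrow> (real^2 \<Rightarrow> real) \<Rightarrow> (real^2 \<Rightarrow> real^2) \<Rightarrow> bool" where
  "has_weak_gradient \<Omega> f g \<longleftrightarrow> f \<in> L2 \<Omega> \<and> g \<in> L2 \<Omega> \<and>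
     (\<forall>\<phi>\<in>test_functions \<Omega>. \<forall>k.
        (\<integral>x. f x * frechet_derivative \<phi> (at x) (axis k 1) \<partial>lebesgue_on \<Omega>)
          = - (\<integral>x. g x $ k * \<phi> x \<partial>lebesgue_on \<Omega>))"

definition Sobolev_H1 :: "(real^2) set \<Rightarrow> (real^2 \<Rightarrow> real) set" where
  "Sobolev_H1 \<Omega> = {f. \<exists>g. has_weak_gradient \<Omega> f g}"

definition X0 :: "(real^2) set \<Rightarrow> field2 set" where
  "X0 \<Omega> = {u. \<forall>i. (\<lambda>x. u x $ i) \<in> L2 \<Omega>}"

definition X1 :: "(real^2) set \<Rightarrow> field2 set" where
  "X1 \<Omega> = {u. \<forall>i. (\<lambda>x. u x $ i) \<in> Sobolev_H1 \<Omega>}"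

text \<open>
  \<open>J\<close> is the Jacobian \<open>J\<bold>u\<close>, row \<open>i\<close> being the gradient of the \<open>i\<close>-th component. It is
  determined by \<open>u\<close> up to null sets, and a field has one iff it lies in \<open>X\<^sub>1\<close>.
\<close>

definition has_weak_jacobian :: "(real^2) set \<Rightarrow> field2 \<Rightarrow> jacobian2 \<Rightarrow> bool" where
  "has_weak_jacobian \<Omega> u J \<longleftrightarrow>
     (\<forall>i. has_weak_gradient \<Omega> (\<lambda>x. u x $ i) (\<lambda>x. J x $ i))"

text \<open>The norm of \<open>X\<^sub>1\<close> at a field \<open>w\<close> with Jacobian \<open>J\<close>.\<close>

definition X1_norm :: "(real^2) set \<Rightarrow> field2 \<Rightarrow> jacobian2 \<Rightarrow> real" where
  "X1_norm \<Omega> w J = sqrt ((L2_norm \<Omega> w)\<^sup>2 + (L2_norm \<Omega> J)\<^sup>2)"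

text \<open>\<open>l\<close> restricts to an element of the dual \<open>(X\<^sub>1)'\<close>; the value \<open>l w\<close> is the duality pairing.\<close>

definition in_X1_dual :: "(real^2) set \<Rightarrow> (field2 \<Rightarrow> real) \<Rightarrow> bool" where
  "in_X1_dual \<Omega> l \<longleftrightarrow>
     (\<forall>v\<in>X1 \<Omega>. \<forall>w\<in>X1 \<Omega>. \<forall>a b. l (\<lambda>x. a *\<^sub>R v x + b *\<^sub>R w x) = a * l v + b * l w) \<and>
     (\<exists>c. \<forall>w J. has_weak_jacobian \<Omega> w J \<longrightarrow> \<bar>l w\<bar> \<le> c * X1_norm \<Omega> w J)"


subsection \<open>Spaces of functions of time\<close>

definition in_C_X0 :: "(real^2) set \<Rightarrow> real \<Rightarrow> (real \<Rightarrow> field2) \<Rightarrow> bool" where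
  "in_C_X0 \<Omega> T u \<longleftrightarrow> (\<forall>t\<in>{0..T}. u t \<in> X0 \<Omega>) \<and>
     (\<forall>s\<in>{0..T}. ((\<lambda>t. L2_norm \<Omega> (\<lambda>x. u t x - u s x)) \<longlongrightarrow> 0) (at s within {0..T}))"

text \<open>
  The Bochner space \<open>L\<^sup>2(0,T;X\<^sub>1)\<close>, with \<open>J t\<close> the Jacobian of \<open>u t\<close>: almost everywhere
  in time \<open>u\<close> has values in \<open>X\<^sub>1\<close>, it is the limit in the norm of \<open>X\<^sub>1\<close> of simple
  \<open>X\<^sub>1\<close>-valued functions (which are given here together with their Jacobians, as pairs), and
  its norm is square integrable.
\<close>

definition in_L2_X1 ::
    "(real^2) set \<Rightarrow> real \<Rightarrow> (real \<Rightarrow> field2) \<Rightarrow> (real \<Rightarrow> jacobian2) \<Rightarrow> bool" where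
  "in_L2_X1 \<Omega> T u J \<longleftrightarrow>
     (AE t in lebesgue_on {0..T}. has_weak_jacobian \<Omega> (u t) (J t)) \<and>
     (\<exists>s :: nat \<Rightarrow> real \<Rightarrow> field2 \<times> jacobian2.
        (\<forall>n. simple_function (lebesgue_on {0..T}) (s n)) \<and>
        (\<forall>n. \<forall>t\<in>{0..T}. has_weak_jacobian \<Omega> (fst (s n t)) (snd (s n t))) \<and>
        (AE t in lebesgue_on {0..T}.
           (\<lambda>n. X1_norm \<Omega> (\<lambda>x. fst (s n t) x - u t x) (\<lambda>x. snd (s n t) x - J t x))
             \<longlonglongrightarrow> 0)) \<and>
     integrable (lebesgue_on {0..T}) (\<lambda>t. (X1_norm \<Omega> (u t) (J t))\<^sup>2)"

text \<open>
  \<open>du\<close> is the distributional time derivative \<open>\<partial>\<^sub>t\<bold>u\<close> on \<open>(0,T)\<close> with values in \<open>(X\<^sub>1)'\<close>,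
  where \<open>X\<^sub>0\<close> is embedded into \<open>(X\<^sub>1)'\<close> by the inner product of \<open>X\<^sub>0\<close>.
\<close>

definition has_time_derivative ::
    "(real^2) set \<Rightarrow> real \<Rightarrow> (real \<Rightarrow> field2) \<Rightarrow> (real \<Rightarrow> field2 \<Rightarrow> real) \<Rightarrow> bool" where
  "has_time_derivative \<Omega> T u du \<longleftrightarrow>
     (AE t in lebesgue_on {0..T}. in_X1_dual \<Omega> (du t)) \<and>
     (\<forall>w\<in>X1 \<Omega>. integrable (lebesgue_on {0..T}) (\<lambda>t. du t w) \<and>
        (\<forall>\<psi>\<in>test_functions {0<..<T}.
           (\<integral>t. (\<integral>x. u t x \<bullet> w x \<partial>lebesgue_on \<Omega>) * deriv \<psi> t \<partial>lebesgue_on {0..T})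
             = - (\<integral>t. du t w * \<psi> t \<partial>lebesgue_on {0..T})))"


subsection \<open>Cross-diffusion\<close>

definition cond_H1 :: "(real^2) set \<Rightarrow> real \<Rightarrow> (real^2 \<Rightarrow> real^2^2) \<Rightarrow> bool" where
  "cond_H1 \<Omega> T D \<longleftrightarrow> (\<exists>\<alpha>>0. \<forall>u :: real \<Rightarrow> field2. \<forall>\<xi>. \<forall>x\<in>closure \<Omega>. \<forall>t\<in>{0..T}.
     \<xi> \<bullet> (D (u t x) *v \<xi>) \<ge> \<alpha> * (norm \<xi>)\<^sup>2)"

definition cond_H2 :: "(real^2) set \<Rightarrow> real \<Rightarrow> (real^2 \<Rightarrow> real^2^2) \<Rightarrow> bool" where
  "cond_H2 \<Omega> T D \<longleftrightarrow> (\<exists>L>0. \<forall>u v :: real \<Rightarrow> field2. \<forall>x\<in>closure \<Omega>. \<forall>t\<in>{0..T}. \<forall>i j.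
     \<bar>D (v t x) $ i $ j - D (u t x) $ i $ j\<bar> \<le> L * norm (v t x - u t x))"

definition cond_H3 :: "(real^2) set \<Rightarrow> real \<Rightarrow> (real^2 \<Rightarrow> real^2^2) \<Rightarrow> bool" where
  "cond_H3 \<Omega> T D \<longleftrightarrow> (\<exists>M>0. \<forall>u :: real \<Rightarrow> field2. \<forall>x\<in>closure \<Omega>. \<forall>t\<in>{0..T}. \<forall>i j.
     \<bar>D (u t x) $ i $ j\<bar> \<le> M)"

text \<open>
  The weak formulation is required for almost every \<open>t\<close>: the slice \<open>u t\<close> of an element of
  \<open>L\<^sup>2(0,T;X\<^sub>1)\<close> and its time derivative are only determined, and only lie in \<open>X\<^sub>1\<close> and
  \<open>(X\<^sub>1)'\<close>, almost everywhere. The exceptional set does not depend on \<open>w\<close>.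
\<close>

definition weak_solution ::
    "(real^2) set \<Rightarrow> (real^2 \<Rightarrow> real^2^2) \<Rightarrow> real \<Rightarrow> field2 \<Rightarrow> (real \<Rightarrow> field2) \<Rightarrow> bool" where
  "weak_solution \<Omega> D T u0 u \<longleftrightarrow>
     in_C_X0 \<Omega> T u \<and>
     (AE x in lebesgue_on \<Omega>. u 0 x = u0 x) \<and>
     (\<exists>Ju du. in_L2_X1 \<Omega> T u Ju \<and> has_time_derivative \<Omega> T u du \<and>
        (AE t in lebesgue_on {0..T}. \<forall>w Jw. has_weak_jacobian \<Omega> w Jw \<longrightarrow>
           du t w
           + (\<integral>x. trace (transpose (Jw x) ** D (u t x) ** Ju t x) \<partial>lebesgue_on \<Omega>) = 0))"

definition unique_weak_solution ::
    "(real^2) set \<Rightarrow> (real^2 \<Rightarrow> real^2^2) \<Rightarrow> real \<Rightarrow> field2 \<Rightarrow> (real \<Rightarrow> field2) \<Rightarrow> bool" where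
  "unique_weak_solution \<Omega> D T u0 u \<longleftrightarrow> weak_solution \<Omega> D T u0 u \<and>
     (\<forall>v. weak_solution \<Omega> D T u0 v \<longrightarrow>
        (\<forall>s\<in>{0..T}. AE x in lebesgue_on \<Omega>. v s x = u s x))"

text \<open>The element of \<open>X\<^sub>0\<close> represented by \<open>f\<close>, as an equivalence class of functions.\<close>

definition X0_class :: "(real^2) set \<Rightarrow> field2 \<Rightarrow> field2 set" where
  "X0_class \<Omega> f = {g \<in> X0 \<Omega>. AE x in lebesgue_on \<Omega>. g x = f x}"

text \<open>
  The scale-space operator \<open>T\<^sub>t\<close>. Its value is an element of \<open>X\<^sub>0\<close>, that is, the class of
  \<open>u t\<close> for the unique weak solution \<open>u\<close> with initial datum \<open>u0\<close> on some time interval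
  containing \<open>t\<close>. It is a partial operator: where the problem is not uniquely solvable, the
  value is the empty set, which is not an element of \<open>X\<^sub>0\<close>.
\<close>

definition scale_space ::
    "(real^2) set \<Rightarrow> (real^2 \<Rightarrow> real^2^2) \<Rightarrow> real \<Rightarrow> field2 \<Rightarrow> field2 set" where
  "scale_space \<Omega> D t u0 =
     \<Union> {X0_class \<Omega> (u t) |T u. 0 < T \<and> t \<le> T \<and> unique_weak_solution \<Omega> D T u0 u}"

text \<open>Addition of the constant function \<open>C\<close> to an element of \<open>X\<^sub>0\<close>.\<close>

definition class_shift :: "real^2 \<Rightarrow> field2 set \<Rightarrow> field2 set" where
  "class_shift C F = (\<lambda>f x. f x + C) ` F"

end

theory Submission
  imports Defs
begin

text \<open>
  Applied to the field \<open>u = 0\<close>, the invariance hypothesis says that \<open>D\<close> is a constant matrix \<open>A\<close>.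
  The problem is then linear and constants have Jacobian zero, so \<open>u\<close> is the unique solution for
  \<open>u\<^sub>0\<close> iff \<open>u + C\<close> is the unique solution for \<open>u\<^sub>0 + C\<close>. It remains to see that a solution \<open>u\<close>
  with initial datum zero vanishes. Its primitive \<open>U t = \<integral>\<^sub>0\<^sup>t u\<close> satisfies
  \<open>(U', w) = - (J w, A (J U))\<close> for all \<open>w\<close> in \<open>X\<^sub>1\<close>; taking \<open>w = U\<close> and using that \<open>A\<close> is coercive,
  \<open>(\<parallel>U\<parallel>\<^sup>2)' \<le> 0\<close>, hence \<open>U = 0\<close>. Working with \<open>U\<close>, which is continuously
  differentiable in time, avoids the energy identity for \<open>u\<close>, whose time derivative only lies in
  the dual of \<open>X\<^sub>1\<close>.
\<close>

section \<open>The inner product of \<open>L\<^sup>2\<close>\<close>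

text \<open>The primitive \<open>U\<close> is never formed as an integral of fields. Half the
  derivative of the squared norm of \<open>U t\<close> is the pairing of \<open>u t\<close> with
  \<open>U t\<close>, that is, the scalar integral of \<open>L2_inner \<Omega> (u t) (u r)\<close>
  over \<open>r\<close> from 0 to \<open>t\<close>, and the dissipation inequality says exactly that
  this number is \<le> 0 for every \<open>t\<close>. Two things must be supplied to test with the
  primitive: it needs a weak Jacobian, and \<open>du r\<close> has to be interchanged with the
  integral over time. Both are immediate for finite sums, which is why approximation by simple
  functions in the norm of \<open>X1\<close>, with an error integrable in time, is prepared at
  length. The distributional time derivative is integrated against one fixed test field at a time,
  which yields an identity at every \<open>t\<close> instead of almost every one; the smooth cutoffs
  in one variable serve this purpose. The shift law is a correspondence between the unique solutions
  for two data, so it also covers an empty value of \<open>scale_space\<close>.\<close>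

definition L2_inner ::
    "(real^2) set \<Rightarrow> (real^2 \<Rightarrow> 'b::euclidean_space) \<Rightarrow> (real^2 \<Rightarrow> 'b) \<Rightarrow> real" where
  "L2_inner \<Omega> f g = (\<integral>x. f x \<bullet> g x \<partial>lebesgue_on \<Omega>)"

lemma L2_norm_eq_inner: "L2_norm \<Omega> f = sqrt (L2_inner \<Omega> f f)"
  by (simp add: L2_norm_def L2_inner_def dot_square_norm)

lemma L2_inner_self_nonneg: "0 \<le> L2_inner \<Omega> f f"
  by (simp add: L2_inner_def)

lemma L2_norm_nonneg [simp]: "0 \<le> L2_norm \<Omega> f"
  by (simp add: L2_norm_eq_inner L2_inner_self_nonneg)

lemma L2_norm_power2: "(L2_norm \<Omega> f)\<^sup>2 = L2_inner \<Omega> f f"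
  by (simp add: L2_norm_eq_inner L2_inner_self_nonneg)

lemma L2_inner_commute: "L2_inner \<Omega> f g = L2_inner \<Omega> g f"
  by (simp add: L2_inner_def inner_commute)

lemma integrable_L2_inner:
  fixes f g :: "real^2 \<Rightarrow> 'b::euclidean_space"
  assumes "f \<in> L2 \<Omega>" "g \<in> L2 \<Omega>"
  shows "integrable (lebesgue_on \<Omega>) (\<lambda>x. f x \<bullet> g x)"
proof (rule Bochner_Integration.integrable_bound)
  show "integrable (lebesgue_on \<Omega>) (\<lambda>x. (norm (f x))\<^sup>2 + (norm (g x))\<^sup>2)"
    using assms by (simp add: L2_def)
  show "(\<lambda>x. f x \<bullet> g x) \<in> borel_measurable (lebesgue_on \<Omega>)"
    using assms by (auto simp: L2_def intro!: borel_measurable_inner)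
  have "\<bar>f x \<bullet> g x\<bar> \<le> (norm (f x))\<^sup>2 + (norm (g x))\<^sup>2" for x
  proof -
    have "\<bar>f x \<bullet> g x\<bar> \<le> norm (f x) * norm (g x)"
      by (rule Cauchy_Schwarz_ineq2)
    also have "\<dots> \<le> (norm (f x))\<^sup>2 + (norm (g x))\<^sup>2"
      by (rule order_trans[OF _ order_trans[OF sum_squares_bound[of "norm (f x)" "norm (g x)"]]])
         auto
    finally show ?thesis .
  qed
  then show "AE x in lebesgue_on \<Omega>. norm (f x \<bullet> g x) \<le> norm ((norm (f x))\<^sup>2 + (norm (g x))\<^sup>2)"
    by (auto intro!: AE_I2)
qed

text \<open>Covers at once scalings, coordinate projections, embeddings along an axis and
  multiplication by a constant matrix.\<close>

lemma L2_linear_image: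
  fixes f :: "real^2 \<Rightarrow> 'b::euclidean_space" and h :: "'b \<Rightarrow> 'c::euclidean_space"
  assumes "f \<in> L2 \<Omega>" "linear h"
  shows "(\<lambda>x. h (f x)) \<in> L2 \<Omega>"
proof -
  obtain B where B: "B > 0" "\<And>x. norm (h x) \<le> B * norm x"
    using linear_bounded_pos[OF assms(2)] by blast
  have h: "h \<in> borel_measurable borel"
    by (intro borel_measurable_continuous_onI linear_continuous_on assms(2)
        linear_conv_bounded_linear[THEN iffD1])
  have m: "(\<lambda>x. h (f x)) \<in> borel_measurable (lebesgue_on \<Omega>)"
    using assms(1) h by (auto simp: L2_def intro: measurable_compose)
  have "integrable (lebesgue_on \<Omega>) (\<lambda>x. (norm (h (f x)))\<^sup>2)"
  proof (rule Bochner_Integration.integrable_bound)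
    show "integrable (lebesgue_on \<Omega>) (\<lambda>x. B\<^sup>2 * (norm (f x))\<^sup>2)"
      using assms by (simp add: L2_def)
    show "(\<lambda>x. (norm (h (f x)))\<^sup>2) \<in> borel_measurable (lebesgue_on \<Omega>)"
      using m by measurable
    show "AE x in lebesgue_on \<Omega>. norm ((norm (h (f x)))\<^sup>2) \<le> norm (B\<^sup>2 * (norm (f x))\<^sup>2)"
      using B(2) by (auto intro!: AE_I2 simp flip: power_mult_distrib intro: power_mono)
  qed
  with m show ?thesis by (simp add: L2_def)
qed

lemma L2_add:
  fixes f g :: "real^2 \<Rightarrow> 'b::euclidean_space"
  assumes f: "f \<in> L2 \<Omega>" and g: "g \<in> L2 \<Omega>"
  shows "(\<lambda>x. f x + g x) \<in> L2 \<Omega>"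
proof -
  have "integrable (lebesgue_on \<Omega>) (\<lambda>x. f x \<bullet> f x + 2 * (f x \<bullet> g x) + g x \<bullet> g x)"
    by (intro Bochner_Integration.integrable_add integrable_L2_inner integrable_mult_right f g)
  moreover have "(norm (f x + g x))\<^sup>2 = f x \<bullet> f x + 2 * (f x \<bullet> g x) + g x \<bullet> g x" for x
    by (simp add: power2_norm_eq_inner inner_add_left inner_add_right inner_commute)
  moreover have "(\<lambda>x. f x + g x) \<in> borel_measurable (lebesgue_on \<Omega>)"
    using f g by (auto simp: L2_def intro: borel_measurable_add)
  ultimately show ?thesis
    by (simp add: L2_def)
qed

lemma L2_scaleR:
  fixes f :: "real^2 \<Rightarrow> 'b::euclidean_space"
  assumes "f \<in> L2 \<Omega>"
  shows "(\<lambda>x. c *\<^sub>R f x) \<in> L2 \<Omega>"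
  using L2_linear_image[OF assms, of "\<lambda>y. c *\<^sub>R y"] by (simp add: linear_scale_self)

lemma L2_zero: "(\<lambda>x. 0) \<in> L2 \<Omega>"
  by (simp add: L2_def)

lemma L2_diff:
  fixes f g :: "real^2 \<Rightarrow> 'b::euclidean_space"
  assumes "f \<in> L2 \<Omega>" "g \<in> L2 \<Omega>"
  shows "(\<lambda>x. f x - g x) \<in> L2 \<Omega>"
  using L2_add[OF assms(1) L2_scaleR[OF assms(2), of "-1"]] by simp

lemma L2_sum:
  fixes f :: "'i \<Rightarrow> real^2 \<Rightarrow> 'b::euclidean_space"
  assumes "\<And>i. i \<in> I \<Longrightarrow> f i \<in> L2 \<Omega>"
  shows "(\<lambda>x. \<Sum>i\<in>I. f i x) \<in> L2 \<Omega>"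
  using assms by (induction I rule: infinite_finite_induct) (auto simp: L2_zero intro: L2_add)

lemma L2_const:
  assumes "\<Omega> \<in> lmeasurable"
  shows "(\<lambda>x. c) \<in> L2 \<Omega>"
  using finite_measure.integrable_const[OF finite_measure_lebesgue_on[OF assms]]
  by (simp add: L2_def)

text \<open>Reconciles the componentwise definitions of \<open>X0\<close> and of weak Jacobians with
  vector-valued \<open>L2\<close>, where the inner product calculus lives. The entries may be
  vectors themselves, so that it also applies to Jacobians row by row.\<close>

lemma vec_L2_iff:
  fixes u :: "real^2 \<Rightarrow> ('b::euclidean_space)^'n"
  shows "(\<forall>i. (\<lambda>x. u x $ i) \<in> L2 \<Omega>) \<longleftrightarrow> u \<in> L2 \<Omega>"
proof
  assume *: "\<forall>i. (\<lambda>x. u x $ i) \<in> L2 \<Omega>"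
  have "(\<lambda>x. \<Sum>i\<in>UNIV. axis i (u x $ i)) \<in> L2 \<Omega>"
    by (intro L2_sum L2_linear_image[of _ _ "axis i" for i])
       (use * in \<open>auto intro!: linearI simp: axis_def vec_eq_iff\<close>)
  moreover have "(\<Sum>i\<in>UNIV. axis i (u x $ i)) = u x" for x
    by (simp add: vec_eq_iff axis_def if_distrib cong: if_cong)
  ultimately show "u \<in> L2 \<Omega>" by simp
next
  assume u: "u \<in> L2 \<Omega>"
  have "linear (\<lambda>y :: 'b^'n. y $ i)" for i
    by (auto intro: linearI)
  from L2_linear_image[OF u this] show "\<forall>i. (\<lambda>x. u x $ i) \<in> L2 \<Omega>"
    by blast
qed

lemma X0_eq_L2: "X0 \<Omega> = L2 \<Omega>"
  by (auto simp: X0_def vec_L2_iff)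

lemma L2_inner_add_left:
  assumes "f \<in> L2 \<Omega>" "g \<in> L2 \<Omega>" "h \<in> L2 \<Omega>"
  shows "L2_inner \<Omega> (\<lambda>x. f x + g x) h = L2_inner \<Omega> f h + L2_inner \<Omega> g h"
  using assms by (simp add: L2_inner_def inner_add_left integrable_L2_inner)

lemma L2_inner_diff_left:
  assumes "f \<in> L2 \<Omega>" "g \<in> L2 \<Omega>" "h \<in> L2 \<Omega>"
  shows "L2_inner \<Omega> (\<lambda>x. f x - g x) h = L2_inner \<Omega> f h - L2_inner \<Omega> g h"
  using assms by (simp add: L2_inner_def inner_diff_left integrable_L2_inner)

lemma L2_inner_diff_right:
  assumes "f \<in> L2 \<Omega>" "g \<in> L2 \<Omega>" "h \<in> L2 \<Omega>"
  shows "L2_inner \<Omega> h (\<lambda>x. f x - g x) = L2_inner \<Omega> h f - L2_inner \<Omega> h g"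
  using assms by (simp add: L2_inner_diff_left L2_inner_commute[of \<Omega> h])

lemma L2_inner_scaleR_left: "L2_inner \<Omega> (\<lambda>x. c *\<^sub>R f x) h = c * L2_inner \<Omega> f h"
  by (simp add: L2_inner_def)

lemma L2_inner_scaleR_right: "L2_inner \<Omega> h (\<lambda>x. c *\<^sub>R f x) = c * L2_inner \<Omega> h f"
  by (simp add: L2_inner_def)

lemma L2_inner_sum_left:
  assumes "\<And>i. i \<in> I \<Longrightarrow> f i \<in> L2 \<Omega>" "h \<in> L2 \<Omega>"
  shows "L2_inner \<Omega> (\<lambda>x. \<Sum>i\<in>I. f i x) h = (\<Sum>i\<in>I. L2_inner \<Omega> (f i) h)"
  using assms unfolding L2_inner_def
  by (simp add: inner_sum_left Bochner_Integration.integral_sum integrable_L2_inner)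

lemma L2_inner_sum_right:
  assumes "\<And>i. i \<in> I \<Longrightarrow> f i \<in> L2 \<Omega>" "h \<in> L2 \<Omega>"
  shows "L2_inner \<Omega> h (\<lambda>x. \<Sum>i\<in>I. f i x) = (\<Sum>i\<in>I. L2_inner \<Omega> h (f i))"
  using L2_inner_sum_left[OF assms] by (simp add: L2_inner_commute[of \<Omega> h])

lemma L2_norm_add_power2:
  assumes "f \<in> L2 \<Omega>" "g \<in> L2 \<Omega>"
  shows "(L2_norm \<Omega> (\<lambda>x. f x + g x))\<^sup>2
    = (L2_norm \<Omega> f)\<^sup>2 + 2 * L2_inner \<Omega> f g + (L2_norm \<Omega> g)\<^sup>2"
proof -
  have "L2_inner \<Omega> h (\<lambda>x. f x + g x) = L2_inner \<Omega> h f + L2_inner \<Omega> h g" if "h \<in> L2 \<Omega>" for h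
    using assms that by (simp add: L2_inner_add_left L2_inner_commute[of \<Omega> h])
  then show ?thesis
    using assms by (simp add: L2_norm_power2 L2_inner_add_left L2_add L2_inner_commute[of \<Omega> g f])
qed

text \<open>The discriminant argument for the squared norm of f + t g, minimal at t = - b / a. On
  functions, as opposed to classes, the form is only semidefinite, hence the separate case of a
  vanishing leading coefficient.\<close>

lemma L2_Cauchy_Schwarz:
  fixes f g :: "real^2 \<Rightarrow> 'b::euclidean_space"
  assumes f: "f \<in> L2 \<Omega>" and g: "g \<in> L2 \<Omega>"
  shows "\<bar>L2_inner \<Omega> f g\<bar> \<le> L2_norm \<Omega> f * L2_norm \<Omega> g"
proof -
  let ?a = "L2_inner \<Omega> g g" and ?b = "L2_inner \<Omega> f g" and ?c = "L2_inner \<Omega> f f"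
  have q: "0 \<le> ?c + 2 * t * ?b + t\<^sup>2 * ?a" for t
  proof -
    have "0 \<le> (L2_norm \<Omega> (\<lambda>x. f x + t *\<^sub>R g x))\<^sup>2" by simp
    also have "\<dots> = ?c + 2 * t * ?b + t\<^sup>2 * ?a"
      using L2_norm_add_power2[OF f L2_scaleR[OF g]]
      unfolding L2_norm_power2 L2_inner_scaleR_left L2_inner_scaleR_right
      by (simp add: power2_eq_square mult_ac)
    finally show ?thesis .
  qed
  have "?b\<^sup>2 \<le> ?c * ?a"
  proof (cases "?a = 0")
    case True
    have "?b = 0"
    proof (rule ccontr)
      \<comment> \<open>With \<open>?a = 0\<close> the nonnegative polynomial is affine in t; the
        value of t used next makes it equal to -1.\<close>
      assume "?b \<noteq> 0"
      then have "2 * (- (?c + 1) / (2 * ?b)) * ?b = - (?c + 1)" by simp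
      with q[of "- (?c + 1) / (2 * ?b)"] True show False by simp
    qed
    with True show ?thesis by simp
  next
    case False
    then have "?a > 0" using L2_inner_self_nonneg[of \<Omega> g] by simp
    have "0 \<le> ?a * (?c + 2 * (- ?b / ?a) * ?b + (- ?b / ?a)\<^sup>2 * ?a)"
      by (rule mult_nonneg_nonneg[OF L2_inner_self_nonneg q])
    also have "\<dots> = ?c * ?a - ?b\<^sup>2"
      using \<open>?a > 0\<close> by (simp add: field_simps power2_eq_square)
    finally show ?thesis by simp
  qed
  then have "sqrt (?b\<^sup>2) \<le> sqrt (?c * ?a)" by (rule real_sqrt_le_mono)
  then show ?thesis by (simp add: L2_norm_eq_inner real_sqrt_mult)
qed

lemma L2_norm_triangle:
  assumes f: "f \<in> L2 \<Omega>" and g: "g \<in> L2 \<Omega>"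
  shows "L2_norm \<Omega> (\<lambda>x. f x + g x) \<le> L2_norm \<Omega> f + L2_norm \<Omega> g"
proof (rule power2_le_imp_le)
  show "(L2_norm \<Omega> (\<lambda>x. f x + g x))\<^sup>2 \<le> (L2_norm \<Omega> f + L2_norm \<Omega> g)\<^sup>2"
    using L2_Cauchy_Schwarz[OF f g] by (simp add: L2_norm_add_power2[OF f g] power2_sum)
qed simp

lemma L2_norm_zero [simp]: "L2_norm \<Omega> (\<lambda>x. 0) = 0"
  by (simp add: L2_norm_def)

lemma L2_norm_minus_commute: "L2_norm \<Omega> (\<lambda>x. f x - g x) = L2_norm \<Omega> (\<lambda>x. g x - f x)"
  by (simp add: L2_norm_def norm_minus_commute)

lemma L2_norm_eq_0_imp_AE:
  assumes "f \<in> L2 \<Omega>" "L2_norm \<Omega> f = 0"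
  shows "AE x in lebesgue_on \<Omega>. f x = 0"
proof -
  have "integrable (lebesgue_on \<Omega>) (\<lambda>x. (norm (f x))\<^sup>2)"
    and "(\<integral>x. (norm (f x))\<^sup>2 \<partial>lebesgue_on \<Omega>) = 0"
    using assms by (auto simp: L2_def L2_norm_def)
  then have "AE x in lebesgue_on \<Omega>. (norm (f x))\<^sup>2 = 0"
    by (subst (asm) integral_nonneg_eq_0_iff_AE) auto
  then show ?thesis by simp
qed

section \<open>Test functions of one variable\<close>

text \<open>Proved from Frechet derivatives because the one-variable characterisation below depends
  on it: on the line the derivative in direction h is h times the ordinary one.\<close>

lemma C_diff_cmult:
  assumes "C_diff n f"
  shows "C_diff n (\<lambda>x. c * f x)"
  using assms
proof (induction n arbitrary: f)
  case 0
  then show ?case by (auto intro: continuous_on_mult_left)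
next
  case (Suc n)
  have "((\<lambda>x. c * f x) has_derivative (\<lambda>h. c * frechet_derivative f (at x) h)) (at x)" for x
    using Suc.prems by (auto intro!: has_derivative_mult_right simp flip: frechet_derivative_works)
  then have "(\<forall>x. (\<lambda>x. c * f x) differentiable at x) \<and>
      (\<forall>x. frechet_derivative (\<lambda>x. c * f x) (at x) = (\<lambda>h. c * frechet_derivative f (at x) h))"
    by (auto simp: differentiable_def dest: frechet_derivative_at[symmetric])
  with Suc show ?case by simp
qed

text \<open>On the line every directional derivative is a multiple of the one in direction 1. The
  quantifier over directions thus collapses to a single \<open>f'\<close>, the form in which the
  inductions for sums, products and affine substitutions are carried out.\<close>

lemma C_diff_Suc_real_iff:
  fixes f :: "real \<Rightarrow> real"
  shows "C_diff (Suc n) f \<longleftrightarrow> (\<exists>f'. (\<forall>x. (f has_real_derivative f' x) (at x)) \<and> C_diff n f')"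
proof
  assume C: "C_diff (Suc n) f"
  have "(f has_real_derivative frechet_derivative f (at x) 1) (at x)" for x
  proof -
    have d: "(f has_derivative frechet_derivative f (at x)) (at x)"
      using C by (simp add: frechet_derivative_works)
    have "frechet_derivative f (at x) h = frechet_derivative f (at x) 1 * h" for h
      using linear_scale[OF has_derivative_linear[OF d], of h 1] by simp
    then have "frechet_derivative f (at x) = (*) (frechet_derivative f (at x) 1)" by (rule ext)
    with d show ?thesis by (metis has_field_derivative_def)
  qed
  with C show "\<exists>f'. (\<forall>x. (f has_real_derivative f' x) (at x)) \<and> C_diff n f'"
    by (intro exI[of _ "\<lambda>x. frechet_derivative f (at x) 1"]) simp
next
  assume "\<exists>f'. (\<forall>x. (f has_real_derivative f' x) (at x)) \<and> C_diff n f'"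
  then obtain f' where f': "\<And>x. (f has_real_derivative f' x) (at x)" "C_diff n f'"
    by blast
  have "frechet_derivative f (at x) = (*) (f' x)" for x
    using f'(1)[of x] by (simp add: has_field_derivative_def frechet_derivative_at[symmetric])
  then have "C_diff n (\<lambda>x. frechet_derivative f (at x) h)" for h
    using C_diff_cmult[OF f'(2), of h] by (simp add: mult.commute[of h])
  moreover have "f differentiable at x" for x
    using f'(1) by (auto simp: real_differentiable_def)
  ultimately show "C_diff (Suc n) f" by simp
qed

lemma C_diff_SucD:
  fixes f :: "real \<Rightarrow> real"
  assumes "C_diff (Suc n) f"
  shows "C_diff n f"
  using assms
proof (induction n arbitrary: f)
  case 0
  then show ?case
    unfolding C_diff_Suc_real_iff C_diff.simps
    by (blast intro: continuous_at_imp_continuous_on DERIV_isCont)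
next
  case (Suc n)
  then show ?case
    unfolding C_diff_Suc_real_iff[of "Suc n"] C_diff_Suc_real_iff[of n f] by blast
qed

lemma C_diff_const: "C_diff n (\<lambda>x::real. c)"
proof (induction n arbitrary: c)
  case (Suc n)
  then show ?case
    unfolding C_diff_Suc_real_iff by (intro exI[of _ "\<lambda>x. 0"]) auto
qed simp

lemma C_diff_add:
  fixes f g :: "real \<Rightarrow> real"
  assumes "C_diff n f" "C_diff n g"
  shows "C_diff n (\<lambda>x. f x + g x)"
  using assms
proof (induction n arbitrary: f g)
  case 0
  then show ?case by (auto intro: continuous_on_add)
next
  case (Suc n)
  then obtain f' g' where
    "\<And>x. (f has_real_derivative f' x) (at x)" "C_diff n f'"
    "\<And>x. (g has_real_derivative g' x) (at x)" "C_diff n g'"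
    unfolding C_diff_Suc_real_iff by blast
  with Suc.IH show ?case
    unfolding C_diff_Suc_real_iff
    by (intro exI[of _ "\<lambda>x. f' x + g' x"]) (simp add: DERIV_add)
qed

lemma C_diff_mult:
  fixes f g :: "real \<Rightarrow> real"
  assumes "C_diff n f" "C_diff n g"
  shows "C_diff n (\<lambda>x. f x * g x)"
  using assms
proof (induction n arbitrary: f g)
  case 0
  then show ?case by (auto intro: continuous_on_mult)
next
  case (Suc n)
  then obtain f' g' where *:
    "\<And>x. (f has_real_derivative f' x) (at x)" "C_diff n f'"
    "\<And>x. (g has_real_derivative g' x) (at x)" "C_diff n g'"
    unfolding C_diff_Suc_real_iff by blast
  moreover have "C_diff n f" "C_diff n g"
    using Suc.prems by (auto intro: C_diff_SucD simp del: C_diff.simps)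
  ultimately show ?case
    unfolding C_diff_Suc_real_iff
    by (intro exI[of _ "\<lambda>x. f' x * g x + g' x * f x"])
       (simp add: DERIV_mult C_diff_add Suc.IH)
qed

lemma C_diff_affine:
  fixes f :: "real \<Rightarrow> real"
  assumes "C_diff n f"
  shows "C_diff n (\<lambda>x. f (c * x + d))"
  using assms
proof (induction n arbitrary: f)
  case 0
  then show ?case
    by (auto intro!: continuous_on_compose2[of UNIV f] continuous_intros)
next
  case (Suc n)
  then obtain f' where f': "\<And>x. (f has_real_derivative f' x) (at x)" "C_diff n f'"
    unfolding C_diff_Suc_real_iff by blast
  have "((\<lambda>x. f (c * x + d)) has_real_derivative c * f' (c * x + d)) (at x)" for x
    by (rule DERIV_cong[OF DERIV_chain2[OF f'(1)]]) (auto intro!: derivative_eq_intros)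
  then show ?case
    unfolding C_diff_Suc_real_iff
    by (intro exI[of _ "\<lambda>x. c * f' (c * x + d)"])
       (simp add: C_diff_cmult Suc.IH[OF f'(2)])
qed

section \<open>A smooth step built from exp (-1/x)\<close>

definition flat :: "nat \<Rightarrow> real \<Rightarrow> real" where
  "flat k x = (if x \<le> 0 then 0 else inverse x ^ k * exp (- inverse x))"

text \<open>In the variable y = 1/x this is the decay of y^k / exp y at infinity; on the left of 0
  the function is zero.\<close>

lemma flat_tendsto_0: "(flat k \<longlongrightarrow> 0) (at 0)"
proof -
  have "((\<lambda>x. inverse x ^ k / exp (inverse x)) \<longlongrightarrow> (0::real)) (at_right 0)"
    by (rule filterlim_compose[OF tendsto_power_div_exp_0 filterlim_inverse_at_top_right])
  moreover have "eventually (\<lambda>x. inverse x ^ k / exp (inverse x) = flat k x) (at_right 0)"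
    using eventually_at_right_less[of 0]
    by eventually_elim (simp add: flat_def exp_minus divide_inverse)
  ultimately have "(flat k \<longlongrightarrow> 0) (at_right 0)"
    using Lim_transform_eventually by blast
  moreover have "(flat k \<longlongrightarrow> 0) (at_left 0)"
  proof (rule Lim_transform_eventually[OF tendsto_const])
    show "eventually (\<lambda>x. 0 = flat k x) (at_left 0)"
      unfolding eventually_at_filter by (simp add: flat_def)
  qed
  ultimately show ?thesis
    by (simp add: filterlim_split_at)
qed

text \<open>The derivative stays in the span of the family \<open>flat\<close>, which is the reason
  for carrying the power k along: smoothness of all members then follows by one induction.\<close>

lemma flat_has_derivative:
  "(flat k has_real_derivative flat (k + 2) x - real k * flat (k + 1) x) (at x)"
proof -
  consider "x < 0" | "x = 0" | "x > 0" by linarith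
  then show ?thesis
  proof cases
    case 1
    have "((\<lambda>x. 0) has_real_derivative 0) (at x)" by simp
    then have "(flat k has_real_derivative 0) (at x)"
      by (rule has_field_derivative_transform_within_open[of _ _ _ "{..<0}"])
         (use 1 in \<open>auto simp: flat_def\<close>)
    with 1 show ?thesis by (simp add: flat_def)
  next
    case 2
    \<comment> \<open>Dividing by h adds one factor 1/h, so the difference quotient at 0 is the next
      member of the family. At h = 0 both sides are 0, the left one because division by zero yields
      0.\<close>
    have "(\<lambda>h. (flat k (0 + h) - flat k 0) / h) = flat (Suc k)"
      by (auto simp: flat_def divide_inverse mult_ac)
    then have "(flat k has_real_derivative 0) (at 0)"
      using flat_tendsto_0[of "Suc k"] by (simp add: DERIV_def)
    with 2 show ?thesis by (simp add: flat_def)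
  next
    case 3
    have "((\<lambda>x. inverse x ^ k * exp (- inverse x)) has_real_derivative
        flat (k + 2) x - real k * flat (k + 1) x) (at x)"
    proof -
      have "((\<lambda>x. inverse x ^ k) has_real_derivative - (real k * inverse x ^ Suc k)) (at x)"
      proof (induction k)
        case (Suc k)
        have "((\<lambda>x. inverse x * inverse x ^ k) has_real_derivative
            - (inverse x * inverse x) * inverse x ^ k + - (real k * inverse x ^ Suc k) * inverse x) (at x)"
          by (intro DERIV_mult Suc) (use 3 in \<open>auto intro!: derivative_eq_intros\<close>)
        then show ?case
          unfolding power_Suc by (rule DERIV_cong) (simp add: algebra_simps)
      qed simp
      moreover have "((\<lambda>x. exp (- inverse x)) has_real_derivative exp (- inverse x) * inverse x ^ 2) (at x)"
        using 3 by (auto intro!: derivative_eq_intros simp: power2_eq_square)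
      ultimately have "((\<lambda>x. inverse x ^ k * exp (- inverse x)) has_real_derivative
          - (real k * inverse x ^ Suc k) * exp (- inverse x)
          + exp (- inverse x) * inverse x ^ 2 * inverse x ^ k) (at x)"
        by (rule DERIV_mult)
      then show ?thesis
        by (rule DERIV_cong) (use 3 in \<open>simp add: flat_def algebra_simps power2_eq_square\<close>)
    qed
    then show ?thesis
      by (rule has_field_derivative_transform_within_open[of _ _ _ "{0<..}"])
         (use 3 in \<open>auto simp: flat_def\<close>)
  qed
qed

lemma C_diff_flat: "C_diff n (flat k)"
proof (induction n arbitrary: k)
  case 0
  then show ?case
    using flat_has_derivative by (auto intro!: continuous_at_imp_continuous_on DERIV_isCont)
next
  case (Suc n)
  have "C_diff n (\<lambda>x. flat (k + 2) x + (- real k) * flat (k + 1) x)"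
    by (intro C_diff_add C_diff_cmult Suc)
  then show ?case
    unfolding C_diff_Suc_real_iff
    by (intro exI[of _ "\<lambda>x. flat (k + 2) x - real k * flat (k + 1) x"])
       (use flat_has_derivative in auto)
qed

text \<open>The normalised antiderivative of a bump supported in the unit interval, the bump being
  the product of \<open>flat 0\<close> and its mirror image about 1/2.\<close>

lemma smooth_step:
  obtains S S' :: "real \<Rightarrow> real" where
    "\<And>n. C_diff n S" "\<And>x. (S has_real_derivative S' x) (at x)"
    "continuous_on UNIV S'" "\<And>x. 0 \<le> S' x"
    "\<And>x. x \<le> 0 \<Longrightarrow> S x = 0" "\<And>x. x \<ge> 1 \<Longrightarrow> S x = 1"
    "\<And>x. 0 \<le> S x" "\<And>x. S x \<le> 1"
    "\<And>x. x \<notin> {0<..<1} \<Longrightarrow> S' x = 0"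
proof -
  define \<eta> where "\<eta> = (\<lambda>x. flat 0 x * flat 0 ((-1) * x + 1))"
  have C: "C_diff n \<eta>" for n
    unfolding \<eta>_def by (rule C_diff_mult[OF C_diff_flat C_diff_affine[OF C_diff_flat]])
  have nonneg: "0 \<le> \<eta> x" and pos: "x \<in> {0<..<1} \<Longrightarrow> 0 < \<eta> x"
    and zero: "x \<notin> {0<..<1} \<Longrightarrow> \<eta> x = 0" for x
    by (auto simp: \<eta>_def flat_def)
  have "continuous_on UNIV \<eta>" using C[of 0] by simp
  \<comment> \<open>Infinite end points are chosen to get one antiderivative on the whole line
    rather than on a bounded interval.\<close>
  then have "\<exists>F. \<forall>x::real. -\<infinity> < ereal x \<longrightarrow> ereal x < \<infinity> \<longrightarrow> (F has_vector_derivative \<eta> x) (at x)"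
    by (intro einterval_antiderivative) (auto simp: continuous_on_eq_continuous_at)
  then obtain P where P: "\<And>x. (P has_real_derivative \<eta> x) (at x)"
    by (auto simp: has_real_derivative_iff_has_vector_derivative)
  have mono: "P x \<le> P y" if "x \<le> y" for x y
    using that P nonneg by (meson DERIV_nonneg_imp_nondecreasing)
  have cont: "continuous_on X P" for X
    using P by (blast intro: continuous_at_imp_continuous_on DERIV_isCont)
  have flatP: "P y = P x" if "x < y" "y \<le> 0 \<or> 1 \<le> x" for x y
  proof (rule DERIV_isconst_end[OF that(1) cont])
    fix z assume "x < z" "z < y"
    with that(2) have "\<eta> z = 0" by (intro zero) auto
    with P[of z] show "(P has_real_derivative 0) (at z)" by simp
  qed
  have lower: "P x = P 0" if "x \<le> 0" for x
    using flatP[of x 0] that by (cases "x = 0") auto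
  have upper: "P x = P 1" if "x \<ge> 1" for x
    using flatP[of 1 x] that by (cases "x = 1") auto
  have "P 0 < P 1"
  proof (rule DERIV_pos_imp_increasing_open[of 0 1 P])
    fix z :: real assume "0 < z" "z < 1"
    then show "\<exists>y. (P has_real_derivative y) (at z) \<and> 0 < y"
      using P pos by (intro exI[of _ "\<eta> z"]) auto
  qed (simp_all add: cont)
  define d where "d = P 1 - P 0"
  have "d > 0" using \<open>P 0 < P 1\<close> by (simp add: d_def)
  define S where "S = (\<lambda>x. inverse d * (P x - P 0))"
  define S' where "S' = (\<lambda>x. inverse d * \<eta> x)"
  show ?thesis
  proof
    show der: "(S has_real_derivative S' x) (at x)" for x
      unfolding S_def S'_def by (rule derivative_eq_intros P refl)+ simp
    show "C_diff n S" for n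
    proof (cases n)
      case 0
      then show ?thesis
        using der by (auto intro!: continuous_at_imp_continuous_on DERIV_isCont)
    next
      case (Suc m)
      have "C_diff m S'" unfolding S'_def by (intro C_diff_cmult C)
      with der Suc show ?thesis by (auto simp: C_diff_Suc_real_iff simp del: C_diff.simps)
    qed
    show "continuous_on UNIV S'"
      unfolding S'_def by (intro continuous_intros \<open>continuous_on UNIV \<eta>\<close>)
    show "0 \<le> S' x" for x using \<open>d > 0\<close> nonneg by (simp add: S'_def)
    show "S x = 0" if "x \<le> 0" for x using lower[OF that] by (simp add: S_def)
    show "S x = 1" if "x \<ge> 1" for x
      using upper[OF that] \<open>d > 0\<close> by (simp add: S_def d_def)
    show "0 \<le> S x" for x
      using lower[of x] mono[of 0 x] \<open>d > 0\<close> by (cases "x \<le> 0") (auto simp: S_def)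
    show "S x \<le> 1" for x
      using upper[of x] mono[of x 1] \<open>d > 0\<close> by (cases "x \<ge> 1") (auto simp: S_def d_def field_simps)
    show "S' x = 0" if "x \<notin> {0<..<1}" for x using zero[OF that] by (simp add: S'_def)
  qed
qed

text \<open>Nonnegative kernels of mass one that live within 2/n of c average f over values close to
  \<open>f c\<close>. The mass is one only eventually, since for small n a kernel may reach beyond
  the interval; c may be an end point. The concentration bound is a product so that n = 0 is no
  exception.\<close>

lemma integral_approximate_identity:
  fixes f :: "real \<Rightarrow> real" and k :: "nat \<Rightarrow> real \<Rightarrow> real"
  assumes f: "continuous_on {0..T} f" and c: "c \<in> {0..T}"
    and k: "\<And>n. continuous_on {0..T} (k n)" "\<And>n t. 0 \<le> k n t"
    and int: "\<forall>\<^sub>F n in sequentially. (\<integral>t. k n t \<partial>lebesgue_on {0..T}) = 1"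
    and supp: "\<And>n t. k n t \<noteq> 0 \<Longrightarrow> \<bar>t - c\<bar> * real n \<le> 2"
  shows "(\<lambda>n. \<integral>t. f t * k n t \<partial>lebesgue_on {0..T}) \<longlonglongrightarrow> f c"
proof (rule LIMSEQ_I)
  let ?M = "lebesgue_on {0..T}"
  fix e :: real assume "e > 0"
  obtain d where d: "d > 0" "\<And>t. t \<in> {0..T} \<Longrightarrow> dist t c < d \<Longrightarrow> dist (f t) (f c) < e / 2"
    using f c \<open>e > 0\<close> unfolding continuous_on_iff by (meson half_gt_zero)
  have "\<forall>\<^sub>F n in sequentially. real n > 2 / d"
    using filterlim_real_sequentially filterlim_at_top_dense by blast
  with int have "\<forall>\<^sub>F n in sequentially. norm ((\<integral>t. f t * k n t \<partial>?M) - f c) < e"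
  proof eventually_elim
    case (elim n)
    have ik: "integrable ?M (k n)"
      by (intro continuous_imp_integrable_real k)
    have ifk: "integrable ?M (\<lambda>t. f t * k n t)"
      by (intro continuous_imp_integrable_real continuous_on_mult k f)
    have "(\<integral>t. f t * k n t \<partial>?M) - f c = (\<integral>t. f t * k n t \<partial>?M) - (\<integral>t. f c * k n t \<partial>?M)"
      using elim by simp
    also have "\<dots> = (\<integral>t. (f t - f c) * k n t \<partial>?M)"
      using ik ifk by (simp add: left_diff_distrib)
    also have "norm \<dots> \<le> (\<integral>t. norm ((f t - f c) * k n t) \<partial>?M)"
      by (rule integral_norm_bound)
    also have "\<dots> \<le> (\<integral>t. e / 2 * k n t \<partial>?M)"
    proof (rule integral_mono)
      show "integrable ?M (\<lambda>t. norm ((f t - f c) * k n t))"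
        using ik ifk by (intro integrable_norm) (simp add: left_diff_distrib)
      fix t assume "t \<in> space ?M"
      then have t: "t \<in> {0..T}" by simp
      show "norm ((f t - f c) * k n t) \<le> e / 2 * k n t"
      proof (cases "k n t = 0")
        case False
        have "real n > 0" using elim(2) d(1) by (meson divide_pos_pos less_trans zero_less_numeral)
        have "\<bar>t - c\<bar> \<le> 2 / real n"
          using supp[OF False] \<open>real n > 0\<close> by (simp add: field_simps)
        also have "\<dots> < d"
          using elim(2) \<open>real n > 0\<close> d(1) by (simp add: field_simps)
        finally have "\<bar>f t - f c\<bar> \<le> e / 2"
          using d(2)[OF t] by (simp add: dist_real_def)
        then show ?thesis
          using mult_right_mono[OF _ k(2)[of n t]] k(2)[of n t] unfolding real_norm_def abs_mult
          by (metis abs_of_nonneg)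
      qed simp
    qed (use ik in simp)
    also have "\<dots> < e" using elim \<open>e > 0\<close> by simp
    finally show ?case .
  qed
  then show "\<exists>no. \<forall>n\<ge>no. norm ((\<integral>t. f t * k n t \<partial>?M) - f c) < e"
    by (simp add: eventually_sequentially)
qed

text \<open>
  Tests with \<open>\<psi> t = S (n (t - a) - 1) + S (n (b - t) - 1) - 1\<close> for a smooth step \<open>S\<close>, which
  approximate the indicator function of \<open>(a, b)\<close> and are supported inside \<open>(a, b)\<close>.
\<close>

lemma integral_weak_derivative:
  fixes f g :: "real \<Rightarrow> real"
  assumes f: "continuous_on {0..T} f" and g: "integrable (lebesgue_on {0..T}) g"
    and weak: "\<And>\<psi>. \<psi> \<in> test_functions {0<..<T} \<Longrightarrow>
      (\<integral>t. f t * deriv \<psi> t \<partial>lebesgue_on {0..T}) = - (\<integral>t. g t * \<psi> t \<partial>lebesgue_on {0..T})"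
    and ab: "0 \<le> a" "a < b" "b \<le> T"
  shows "(\<integral>t. indicator {a<..<b} t * g t \<partial>lebesgue_on {0..T}) = f b - f a"
proof -
  let ?M = "lebesgue_on {0..T}"
  obtain S S' :: "real \<Rightarrow> real" where
    C: "\<And>n. C_diff n S" and der: "\<And>x. (S has_real_derivative S' x) (at x)"
    and cont': "continuous_on UNIV S'" and nn: "\<And>x. 0 \<le> S' x"
    and S0: "\<And>x. x \<le> 0 \<Longrightarrow> S x = 0" and S1: "\<And>x. x \<ge> 1 \<Longrightarrow> S x = 1"
    and Snn: "\<And>x. 0 \<le> S x" and Sle: "\<And>x. S x \<le> 1"
    and S'0: "\<And>x. x \<notin> {0<..<1} \<Longrightarrow> S' x = 0"
    using smooth_step by blast
  \<comment> \<open>The shift by -1 makes the left ramp rise between a + 1/n and a + 2/n, and the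
    right one fall symmetrically before b. The support therefore stays off the end points even if a
    = 0 or b = T, and the derivatives \<open>k n\<close> and \<open>- l n\<close> of the ramps live
    within 2/n of a and b.\<close>
  define \<psi> where "\<psi> = (\<lambda>n::nat. \<lambda>t. S (real n * t + (- real n * a - 1)) + S ((- real n) * t + (real n * b - 1)) + (-1))"
  define k where "k = (\<lambda>n::nat. \<lambda>t. real n * S' (real n * t + (- real n * a - 1)))"
  define l where "l = (\<lambda>n::nat. \<lambda>t. real n * S' ((- real n) * t + (real n * b - 1)))"
  have Sa: "((\<lambda>t. S (real n * t + (- real n * a - 1))) has_real_derivative k n t) (at t)"
    and Sb: "((\<lambda>t. S ((- real n) * t + (real n * b - 1))) has_real_derivative - l n t) (at t)" for n t
    unfolding k_def l_def
    by (rule DERIV_cong[OF DERIV_chain2[OF der]], (rule derivative_eq_intros refl)+, simp)+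
  have der\<psi>: "(\<psi> n has_real_derivative k n t - l n t) (at t)" for n t
    unfolding \<psi>_def by (rule DERIV_cong[OF DERIV_add[OF DERIV_add[OF Sa Sb] DERIV_const]]) simp
  have contk: "continuous_on X (k n)" and contl: "continuous_on X (l n)" for X n
    unfolding k_def l_def
    by (intro continuous_intros continuous_on_compose2[OF cont'] subset_UNIV)+
  have large: "\<forall>\<^sub>F n in sequentially. r \<le> real n * d" if "d > 0" for r d
  proof -
    have "\<forall>\<^sub>F n in sequentially. r / d \<le> real n"
      using filterlim_real_sequentially by (simp add: filterlim_at_top)
    then show ?thesis
      by eventually_elim (use that in \<open>simp add: field_simps\<close>)
  qed
  have lim_a: "(\<lambda>n. \<integral>t. f t * k n t \<partial>?M) \<longlonglongrightarrow> f a"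
  proof (rule integral_approximate_identity[OF f])
    show "\<forall>\<^sub>F n in sequentially. (\<integral>t. k n t \<partial>?M) = 1"
    proof -
      have "T - a > 0" using ab by simp
      from large[OF this, of 2] show ?thesis
      proof eventually_elim
        case (elim n)
        have "(k n has_integral S (real n * T + (- real n * a - 1)) - S (real n * 0 + (- real n * a - 1))) {0..T}"
          by (rule fundamental_theorem_of_calculus)
             (use ab Sa in \<open>auto simp: has_real_derivative_iff_has_vector_derivative
               intro: has_vector_derivative_at_within\<close>)
        moreover have "S (real n * T + (- real n * a - 1)) = 1"
          using elim ab by (intro S1) (auto simp: algebra_simps)
        moreover have "S (real n * 0 + (- real n * a - 1)) = 0"
        proof (rule S0)
          have "0 \<le> real n * a" using ab by simp
          then show "real n * 0 + (- real n * a - 1) \<le> 0" by simp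
        qed
        ultimately show ?case
          by (simp add: lebesgue_integral_eq_integral continuous_imp_integrable_real contk integral_unique)
      qed
    qed
    show "\<bar>t - a\<bar> * real n \<le> 2" if "k n t \<noteq> 0" for n t
    proof -
      have "S' (real n * t + (- real n * a - 1)) \<noteq> 0"
        using that by (simp add: k_def)
      then have "real n * t + (- real n * a - 1) \<in> {0<..<1}"
        using S'0 by blast
      then have "0 \<le> (t - a) * real n" "(t - a) * real n \<le> 2" by (auto simp: algebra_simps)
      then have "\<bar>(t - a) * real n\<bar> \<le> 2" by simp
      then show ?thesis by (simp add: abs_mult)
    qed
  qed (use ab contk nn in \<open>auto simp: k_def\<close>)
  have lim_b: "(\<lambda>n. \<integral>t. f t * l n t \<partial>?M) \<longlonglongrightarrow> f b"
  proof (rule integral_approximate_identity[OF f])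
    show "\<forall>\<^sub>F n in sequentially. (\<integral>t. l n t \<partial>?M) = 1"
    proof -
      have "b > 0" using ab by simp
      from large[OF this, of 2] show ?thesis
      proof eventually_elim
        case (elim n)
        have "((\<lambda>t. - l n t) has_integral S ((- real n) * T + (real n * b - 1)) - S ((- real n) * 0 + (real n * b - 1))) {0..T}"
          by (rule fundamental_theorem_of_calculus)
             (use ab Sb in \<open>auto simp: has_real_derivative_iff_has_vector_derivative
               intro: has_vector_derivative_at_within\<close>)
        moreover have "S ((- real n) * 0 + (real n * b - 1)) = 1"
          using elim ab by (intro S1) (auto simp: algebra_simps)
        moreover have "S ((- real n) * T + (real n * b - 1)) = 0"
          using ab mult_left_mono[of b T "real n"] by (intro S0) auto
        ultimately have "((\<lambda>t. - (- l n t)) has_integral - (0 - 1)) {0..T}"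
          by (intro has_integral_neg) simp
        then show ?case
          by (simp add: lebesgue_integral_eq_integral continuous_imp_integrable_real contl integral_unique)
      qed
    qed
    show "\<bar>t - b\<bar> * real n \<le> 2" if "l n t \<noteq> 0" for n t
    proof -
      have "S' ((- real n) * t + (real n * b - 1)) \<noteq> 0"
        using that by (simp add: l_def)
      then have "(- real n) * t + (real n * b - 1) \<in> {0<..<1}"
        using S'0 by blast
      then have "0 \<le> (b - t) * real n" "(b - t) * real n \<le> 2" by (auto simp: algebra_simps)
      then have "\<bar>(b - t) * real n\<bar> \<le> 2" by simp
      then show ?thesis by (simp add: abs_mult abs_minus_commute)
    qed
  qed (use ab contl nn in \<open>auto simp: l_def\<close>)
  have test: "\<forall>\<^sub>F n in sequentially. \<psi> n \<in> test_functions {0<..<T}"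
  proof -
    have "b - a > 0" using ab by simp
    \<comment> \<open>With n (b - a) \<ge> 4 the ramps do not overlap: where one step is still 0 the
      other is already 1, and the constant -1 cancels it.\<close>
    from large[OF this, of 4] large[OF zero_less_one, of 1] show ?thesis
    proof eventually_elim
      case (elim n)
      have n: "real n > 0" using elim by simp
      have supp: "{t. \<psi> n t \<noteq> 0} \<subseteq> {a + 1 / n..b - 1 / n}"
      proof (rule subsetI, rule ccontr)
        fix t assume t: "t \<in> {t. \<psi> n t \<noteq> 0}" "t \<notin> {a + 1 / n..b - 1 / n}"
        then consider "t < a + 1 / n" | "t > b - 1 / n"
          by (auto simp: not_le)
        then have "\<psi> n t = 0"
        proof cases
          case 1
          then have "t - a < 1 / n" by simp
          then have "real n * (t - a) \<le> 1" using n by (simp add: pos_less_divide_eq mult.commute)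
          then have "S (real n * t + (- real n * a - 1)) = 0"
            "S ((- real n) * t + (real n * b - 1)) = 1"
            using elim by (simp_all add: S0 S1 algebra_simps)
          then show ?thesis by (simp add: \<psi>_def)
        next
          case 2
          then have "b - t < 1 / n" by simp
          then have "real n * (b - t) \<le> 1" using n by (simp add: pos_less_divide_eq mult.commute)
          then have "S (real n * t + (- real n * a - 1)) = 1"
            "S ((- real n) * t + (real n * b - 1)) = 0"
            using elim by (simp_all add: S0 S1 algebra_simps)
          then show ?thesis by (simp add: \<psi>_def)
        qed
        with t show False by simp
      qed
      then have cl: "closure {t. \<psi> n t \<noteq> 0} \<subseteq> {a + 1 / n..b - 1 / n}"
        by (rule closure_minimal) simp
      have "compact (closure {t. \<psi> n t \<noteq> 0})"
        unfolding compact_closure by (rule bounded_subset[OF bounded_closed_interval supp])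
      moreover have "closure {t. \<psi> n t \<noteq> 0} \<subseteq> {0<..<T}"
      proof -
        have *: "{a + \<delta>..b - \<delta>} \<subseteq> {0<..<T}" if "\<delta> > 0" for \<delta>
          using ab that by auto
        have "1 / real n > 0" using elim by simp
        from order_trans[OF cl *[OF this]] show ?thesis .
      qed
      moreover have "C_diff m (\<psi> n)" for m
        unfolding \<psi>_def by (rule C_diff_add[OF C_diff_add[OF C_diff_affine[OF C] C_diff_affine[OF C]] C_diff_const])
      ultimately show ?case by (simp add: test_functions_def)
    qed
  qed
  have lim_g: "(\<lambda>n. \<integral>t. g t * \<psi> n t \<partial>?M) \<longlonglongrightarrow> (\<integral>t. g t * indicator {a<..<b} t \<partial>?M)"
  proof (rule integral_dominated_convergence[where w = "\<lambda>t. \<bar>g t\<bar>"])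
    have "continuous_on UNIV (\<psi> n)" for n
      using der\<psi> by (blast intro: continuous_at_imp_continuous_on DERIV_isCont)
    then have "\<psi> n \<in> borel_measurable ?M" for n
      by (rule continuous_imp_measurable_on_sets_lebesgue[OF continuous_on_subset[OF _ subset_UNIV]]) simp
    then show "(\<lambda>t. g t * \<psi> n t) \<in> borel_measurable ?M" for n
      using g by auto
    show "(\<lambda>t. g t * indicator {a<..<b} t) \<in> borel_measurable ?M"
      by (rule borel_measurable_times[OF borel_measurable_integrable[OF g] borel_measurable_indicator])
         (use ab in \<open>auto simp: sets_restrict_space_iff\<close>)
    show "integrable ?M (\<lambda>t. \<bar>g t\<bar>)" using g by simp
    show "AE t in ?M. (\<lambda>n. g t * \<psi> n t) \<longlonglongrightarrow> g t * indicator {a<..<b} t"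
    proof (intro AE_I2 tendsto_mult tendsto_const)
      fix t
      consider "t \<le> a" | "a < t" "t < b" | "b \<le> t" by linarith
      then have "\<forall>\<^sub>F n in sequentially. \<psi> n t = indicator {a<..<b} t"
      proof cases
        case 1
        with ab have "b - t > 0" by simp
        from large[OF this, of 2] show ?thesis
        proof eventually_elim
          case (elim n)
          have "real n * t \<le> real n * a" using 1 by (simp add: mult_left_mono)
          then show ?case using elim 1 by (simp add: \<psi>_def S0 S1 algebra_simps)
        qed
      next
        case 2
        then have "b - t > 0" "t - a > 0" by auto
        from large[OF this(1), of 2] large[OF this(2), of 2] show ?thesis
          by eventually_elim (use 2 in \<open>simp add: \<psi>_def S1 algebra_simps\<close>)
      next
        case 3
        with ab have "t - a > 0" by simp
        from large[OF this, of 2] show ?thesis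
        proof eventually_elim
          case (elim n)
          have "real n * b \<le> real n * t" using 3 by (simp add: mult_left_mono)
          then show ?case using elim 3 by (simp add: \<psi>_def S0 S1 algebra_simps)
        qed
      qed
      then show "(\<lambda>n. \<psi> n t) \<longlonglongrightarrow> indicator {a<..<b} t"
        by (rule tendsto_eventually)
    qed
    show "AE t in ?M. norm (g t * \<psi> n t) \<le> \<bar>g t\<bar>" for n
    proof (rule AE_I2)
      fix t
      have "\<bar>\<psi> n t\<bar> \<le> 1"
        using Snn[of "real n * t + (- real n * a - 1)"] Sle[of "real n * t + (- real n * a - 1)"]
          Snn[of "(- real n) * t + (real n * b - 1)"] Sle[of "(- real n) * t + (real n * b - 1)"]
        unfolding \<psi>_def by linarith
      then show "norm (g t * \<psi> n t) \<le> \<bar>g t\<bar>"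
        by (simp add: abs_mult mult_left_le)
    qed
  qed
  have "(\<lambda>n. (\<integral>t. f t * k n t \<partial>?M) - (\<integral>t. f t * l n t \<partial>?M)) \<longlonglongrightarrow> f a - f b"
    by (intro tendsto_diff lim_a lim_b)
  moreover have "\<forall>\<^sub>F n in sequentially.
      (\<integral>t. f t * k n t \<partial>?M) - (\<integral>t. f t * l n t \<partial>?M) = - (\<integral>t. g t * \<psi> n t \<partial>?M)"
    using test
  proof eventually_elim
    case (elim n)
    have d: "deriv (\<psi> n) t = k n t - l n t" for t
      using der\<psi> by (rule DERIV_imp_deriv)
    have "integrable ?M (\<lambda>t. f t * k n t)" "integrable ?M (\<lambda>t. f t * l n t)"
      by (intro continuous_imp_integrable_real continuous_on_mult f contk contl)+
    then have "(\<integral>t. f t * deriv (\<psi> n) t \<partial>?M) = (\<integral>t. f t * k n t \<partial>?M) - (\<integral>t. f t * l n t \<partial>?M)"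
      by (simp add: d right_diff_distrib)
    with weak[OF elim] show ?case by simp
  qed
  ultimately have "(\<lambda>n. - (\<integral>t. g t * \<psi> n t \<partial>?M)) \<longlonglongrightarrow> f a - f b"
    by (rule Lim_transform_eventually)
  moreover have "(\<lambda>n. - (\<integral>t. g t * \<psi> n t \<partial>?M)) \<longlonglongrightarrow> - (\<integral>t. g t * indicator {a<..<b} t \<partial>?M)"
    by (intro tendsto_minus lim_g)
  ultimately have "f a - f b = - (\<integral>t. g t * indicator {a<..<b} t \<partial>?M)"
    by (rule LIMSEQ_unique)
  then show ?thesis by (simp add: mult.commute)
qed

section \<open>Weak derivatives\<close>

lemma has_derivative_test_function:
  assumes "\<phi> \<in> test_functions S"
  shows "(\<phi> has_derivative frechet_derivative \<phi> (at x)) (at x)"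
proof -
  have "C_diff (Suc 0) \<phi>" using assms by (auto simp: test_functions_def simp del: C_diff.simps)
  then have "\<phi> differentiable (at x)" by simp
  then show ?thesis by (rule frechet_derivative_works[THEN iffD1])
qed

text \<open>The complement of the support is open, so off the support the function vanishes on a
  neighbourhood and its derivative vanishes too.\<close>

lemma test_function_eq_0:
  assumes "\<phi> \<in> test_functions S" "x \<notin> closure {x. \<phi> x \<noteq> 0}"
  shows "\<phi> x = 0" and "frechet_derivative \<phi> (at x) h = 0"
proof -
  define K where "K = closure {x. \<phi> x \<noteq> 0}"
  have out: "\<phi> y = 0" if "y \<notin> K" for y
    using that closure_subset[of "{x. \<phi> x \<noteq> 0}"] by (auto simp: K_def)
  have x: "x \<notin> K" and "closed K" using assms(2) by (auto simp: K_def)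
  then show "\<phi> x = 0" using out by blast
  have "((\<lambda>x. 0) has_derivative (\<lambda>h. 0)) (at x)" by simp
  then have "(\<phi> has_derivative (\<lambda>h. 0)) (at x)"
    by (rule has_derivative_transform_within_open[of _ _ _ _ "- K"])
       (use x out \<open>closed K\<close> in auto)
  from frechet_derivative_at[OF this] show "frechet_derivative \<phi> (at x) h = 0"
    by (simp add: fun_eq_iff)
qed

lemma continuous_on_test_function:
  assumes "\<phi> \<in> test_functions S"
  shows "continuous_on X \<phi>" and "continuous_on X (\<lambda>x. frechet_derivative \<phi> (at x) h)"
proof -
  have "C_diff 0 \<phi>" "C_diff (Suc 0) \<phi>"
    using assms by (auto simp: test_functions_def simp del: C_diff.simps)
  then have "continuous_on UNIV \<phi>" "continuous_on UNIV (\<lambda>x. frechet_derivative \<phi> (at x) h)"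
    by auto
  then show "continuous_on X \<phi>" "continuous_on X (\<lambda>x. frechet_derivative \<phi> (at x) h)"
    by (auto intro: continuous_on_subset)
qed

lemma bounded_test_function:
  assumes "\<phi> \<in> test_functions S"
  shows "\<exists>B. \<forall>x. \<bar>\<phi> x\<bar> \<le> B" and "\<exists>B. \<forall>x. \<bar>frechet_derivative \<phi> (at x) h\<bar> \<le> B"
proof -
  let ?K = "closure {x. \<phi> x \<noteq> 0}"
  have bound: "\<exists>B. \<forall>x. \<bar>f x\<bar> \<le> B"
    if "continuous_on ?K f" "\<And>x. x \<notin> ?K \<Longrightarrow> f x = 0" for f :: "_ \<Rightarrow> real"
  proof -
    have "compact ?K" using assms by (simp add: test_functions_def)
    then have "bounded (f ` ?K)"
      by (intro compact_imp_bounded compact_continuous_image that(1))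
    then obtain B where B: "\<And>x. x \<in> ?K \<Longrightarrow> \<bar>f x\<bar> \<le> B"
      by (auto simp: bounded_iff)
    have "\<bar>f x\<bar> \<le> max B 0" for x
      using B[of x] that(2)[of x] by (cases "x \<in> ?K") auto
    then show ?thesis by blast
  qed
  show "\<exists>B. \<forall>x. \<bar>\<phi> x\<bar> \<le> B"
    by (intro bound continuous_on_test_function[OF assms] test_function_eq_0[OF assms])
  show "\<exists>B. \<forall>x. \<bar>frechet_derivative \<phi> (at x) h\<bar> \<le> B"
    by (intro bound continuous_on_test_function[OF assms] test_function_eq_0[OF assms])
qed

text \<open>By translation invariance the difference quotients of a test function have integral zero.\<close>

lemma integral_derivative_test_function:
  fixes \<phi> :: "'a::euclidean_space \<Rightarrow> real"
  assumes \<phi>: "\<phi> \<in> test_functions S"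
  shows "(\<integral>x. frechet_derivative \<phi> (at x) h \<partial>lborel) = 0"
proof -
  let ?g = "\<lambda>x. frechet_derivative \<phi> (at x) h"
  define K where "K = closure {x. \<phi> x \<noteq> 0}"
  have K0: "\<phi> x = 0" if "x \<notin> K" for x
    using test_function_eq_0(1)[OF \<phi>] that unfolding K_def by blast
  define q where "q = (\<lambda>n::nat. \<lambda>x. (\<phi> (x + inverse (real (Suc n)) *\<^sub>R h) - \<phi> x) / inverse (real (Suc n)))"
  obtain B where B: "\<And>x. \<bar>?g x\<bar> \<le> B" using bounded_test_function(2)[OF \<phi>] by blast
  have "bounded K" using \<phi> by (simp add: K_def test_functions_def compact_imp_bounded)
  then obtain R where R: "\<And>x. x \<in> K \<Longrightarrow> norm x \<le> R" by (auto simp: bounded_iff)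
  have meas: "\<phi> \<in> borel_measurable borel" "?g \<in> borel_measurable borel"
    using continuous_on_test_function[OF \<phi>] by (auto intro: borel_measurable_continuous_onI)
  have lim: "(\<lambda>n. q n x) \<longlonglongrightarrow> ?g x" for x
  proof -
    have "((\<lambda>s. \<phi> (x + s *\<^sub>R h)) has_derivative (\<lambda>s. frechet_derivative \<phi> (at x) (s *\<^sub>R h))) (at 0)"
      by (rule has_derivative_compose[of "\<lambda>s. x + s *\<^sub>R h" "\<lambda>s. s *\<^sub>R h" 0 UNIV \<phi>, simplified])
         (auto intro!: derivative_eq_intros has_derivative_test_function[OF \<phi>])
    moreover have "frechet_derivative \<phi> (at x) (s *\<^sub>R h) = ?g x * s" for s
      using linear_scale[OF has_derivative_linear[OF has_derivative_test_function[OF \<phi>]]]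
      by (simp add: mult.commute)
    ultimately have "((\<lambda>s. \<phi> (x + s *\<^sub>R h)) has_real_derivative ?g x) (at 0)"
      by (simp add: has_field_derivative_def)
    then have "((\<lambda>s. (\<phi> (x + s *\<^sub>R h) - \<phi> x) / s) \<longlongrightarrow> ?g x) (at 0)"
      by (simp add: DERIV_def)
    moreover have "filterlim (\<lambda>n. inverse (real (Suc n))) (at 0) sequentially"
      using LIMSEQ_inverse_real_of_nat by (auto simp: filterlim_at)
    ultimately show ?thesis
      unfolding q_def by (rule filterlim_compose)
  qed
  \<comment> \<open>Inside the ball the mean value theorem along direction h bounds the quotient by
    \<open>B\<close>. Outside, x and its translate both miss \<open>K\<close>, because the
    translation is by at most \<open>norm h\<close>.\<close>
  have dom: "\<bar>q n x\<bar> \<le> B * indicator (cball 0 (R + norm h)) x" for n x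
  proof -
    let ?s = "inverse (real (Suc n))"
    have s: "0 < ?s" "?s \<le> 1" by (auto simp: field_simps)
    show ?thesis
    proof (cases "x \<in> cball 0 (R + norm h)")
      case True
      have der: "((\<lambda>s. \<phi> (x + s *\<^sub>R h)) has_real_derivative ?g (x + z *\<^sub>R h)) (at z)" for z
      proof -
        have "((\<lambda>s. \<phi> (x + s *\<^sub>R h)) has_derivative (\<lambda>s. frechet_derivative \<phi> (at (x + z *\<^sub>R h)) (s *\<^sub>R h))) (at z)"
          by (rule has_derivative_compose[of "\<lambda>s. x + s *\<^sub>R h" "\<lambda>s. s *\<^sub>R h" z UNIV \<phi>])
             (auto intro!: derivative_eq_intros has_derivative_test_function[OF \<phi>])
        moreover have "frechet_derivative \<phi> (at (x + z *\<^sub>R h)) (s *\<^sub>R h) = ?g (x + z *\<^sub>R h) * s" for s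
          using linear_scale[OF has_derivative_linear[OF has_derivative_test_function[OF \<phi>]]]
          by (simp add: mult.commute)
        ultimately show ?thesis by (simp add: has_field_derivative_def)
      qed
      obtain z where "\<phi> (x + ?s *\<^sub>R h) - \<phi> (x + 0 *\<^sub>R h) = (?s - 0) * ?g (x + z *\<^sub>R h)"
        using MVT2[OF s(1), of "\<lambda>s. \<phi> (x + s *\<^sub>R h)" "\<lambda>z. ?g (x + z *\<^sub>R h)"] der by blast
      then have "q n x = ?g (x + z *\<^sub>R h)" using s(1) by (simp add: q_def)
      with B True show ?thesis by simp
    next
      case False
      then have "norm x > R + norm h" by simp
      moreover have "norm (?s *\<^sub>R h) \<le> norm h"
        using s by (simp add: mult_left_le_one_le)
      moreover have "norm x \<le> norm (x + ?s *\<^sub>R h) + norm (?s *\<^sub>R h)"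
        using norm_triangle_ineq4[of "x + ?s *\<^sub>R h" "?s *\<^sub>R h"] by simp
      ultimately have "norm x > R" "norm (x + ?s *\<^sub>R h) > R"
        using norm_ge_zero[of h] by linarith+
      then have "x \<notin> K" "x + ?s *\<^sub>R h \<notin> K" using R by (meson not_le)+
      then show ?thesis using False by (simp add: q_def K0)
    qed
  qed
  have int\<phi>: "integrable lborel \<phi>"
  proof -
    obtain B' where B': "\<And>x. \<bar>\<phi> x\<bar> \<le> B'" using bounded_test_function(1)[OF \<phi>] by blast
    have "integrable lborel (\<lambda>x. B' * indicator (cball 0 R) x :: real)"
      using emeasure_lborel_cball_finite
      by (intro integrable_mult_right integrable_real_indicator) (simp_all flip: infinity_ennreal_def)
    then show ?thesis
    proof (rule Bochner_Integration.integrable_bound)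
      have "norm (\<phi> x) \<le> norm (B' * indicator (cball 0 R) x :: real)" for x
        using B'[of x] R[of x] K0[of x] by (cases "x \<in> K") auto
      then show "AE x in lborel. norm (\<phi> x) \<le> norm (B' * indicator (cball 0 R) x :: real)" by simp
    qed (use meas in simp)
  qed
  have zero: "(\<integral>x. q n x \<partial>lborel) = 0" for n
  proof -
    let ?c = "inverse (real (Suc n)) *\<^sub>R h"
    have d: "distr lborel borel ((+) ?c) = (lborel :: 'a measure)" by (rule lborel_distr_plus)
    have "integrable (distr lborel borel ((+) ?c)) \<phi>" unfolding d by (rule int\<phi>)
    then have i: "integrable lborel (\<lambda>x. \<phi> (x + ?c))"
      by (subst (asm) integrable_distr_eq) (use meas in \<open>auto simp: add.commute\<close>)
    have "(\<integral>x. \<phi> x \<partial>distr lborel borel ((+) ?c)) = (\<integral>x. \<phi> (x + ?c) \<partial>lborel)"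
      by (subst integral_distr) (use meas in \<open>auto simp: add.commute\<close>)
    then have "(\<integral>x. \<phi> (x + ?c) \<partial>lborel) = (\<integral>x. \<phi> x \<partial>lborel)" unfolding d by simp
    with i int\<phi> show ?thesis by (simp add: q_def)
  qed
  have "(\<lambda>n. \<integral>x. q n x \<partial>lborel) \<longlonglongrightarrow> (\<integral>x. ?g x \<partial>lborel)"
  proof (rule integral_dominated_convergence[where w = "\<lambda>x. B * indicator (cball 0 (R + norm h)) x"])
    show "integrable lborel (\<lambda>x. B * indicator (cball 0 (R + norm h)) x :: real)"
      using emeasure_lborel_cball_finite
      by (intro integrable_mult_right integrable_real_indicator) (simp_all flip: infinity_ennreal_def)
    show "q n \<in> borel_measurable lborel" for n
      using meas(1) unfolding q_def by measurable
  qed (use meas lim dom in auto)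
  then show ?thesis by (simp add: zero LIMSEQ_const_iff)
qed

lemma bounded_domain_lmeasurable: "bounded_domain \<Omega> \<Longrightarrow> \<Omega> \<in> lmeasurable"
  by (simp add: bounded_domain_def lmeasurable_open)

text \<open>The derivative vanishes outside \<open>S\<close>, so the integral over \<open>U\<close>
  is the one over the whole space. It is applied in space with \<open>S\<close> and \<open>U\<close>
  both \<Omega>, and in time with the open and the closed interval.\<close>

lemma integral_derivative_test_function_on:
  fixes \<phi> :: "'a::euclidean_space \<Rightarrow> real"
  assumes \<phi>: "\<phi> \<in> test_functions S" and "S \<subseteq> U" "U \<in> sets lebesgue"
  shows "(\<integral>x. frechet_derivative \<phi> (at x) h \<partial>lebesgue_on U) = 0"
proof -
  let ?g = "\<lambda>x. frechet_derivative \<phi> (at x) h"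
  have "closure {x. \<phi> x \<noteq> 0} \<subseteq> S" using \<phi> by (auto simp: test_functions_def)
  then have out: "?g x = 0" if "x \<notin> U" for x
    using test_function_eq_0(2)[OF \<phi>, of x h] that assms(2) by blast
  have "(\<integral>x. ?g x \<partial>lebesgue_on U) = (\<integral>x. indicator U x *\<^sub>R ?g x \<partial>lebesgue)"
    using assms(3) by (intro integral_restrict_space) auto
  also have "\<dots> = (\<integral>x. ?g x \<partial>lebesgue)"
    by (rule Bochner_Integration.integral_cong[OF refl]) (use out in \<open>auto simp: indicator_def\<close>)
  also have "\<dots> = (\<integral>x. ?g x \<partial>lborel)"
    using continuous_on_test_function(2)[OF \<phi>]
    by (intro integral_completion) (auto intro: borel_measurable_continuous_onI)
  finally show ?thesis using integral_derivative_test_function[OF \<phi>] by simp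
qed

section \<open>Weak gradients and Jacobians of constants, sums and multiples\<close>

lemma L2_bounded_continuous:
  fixes f :: "real^2 \<Rightarrow> 'b::euclidean_space"
  assumes "\<Omega> \<in> lmeasurable" "continuous_on UNIV f" "\<And>x. norm (f x) \<le> B"
  shows "f \<in> L2 \<Omega>"
proof -
  have m: "f \<in> borel_measurable (lebesgue_on \<Omega>)"
    by (rule continuous_imp_measurable_on_sets_lebesgue[OF continuous_on_subset[OF assms(2) subset_UNIV]])
       (use assms(1) in auto)
  have "integrable (lebesgue_on \<Omega>) (\<lambda>x. (norm (f x))\<^sup>2)"
  proof (rule Bochner_Integration.integrable_bound)
    show "integrable (lebesgue_on \<Omega>) (\<lambda>x. B\<^sup>2)"
      by (rule finite_measure.integrable_const[OF finite_measure_lebesgue_on[OF assms(1)]])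
    show "AE x in lebesgue_on \<Omega>. norm ((norm (f x))\<^sup>2) \<le> norm (B\<^sup>2)"
      using assms(3) by (auto intro!: AE_I2 power_mono)
  qed (use m in measurable)
  with m show ?thesis by (simp add: L2_def)
qed

lemma test_function_L2:
  assumes "\<Omega> \<in> lmeasurable" "\<phi> \<in> test_functions S"
  shows "\<phi> \<in> L2 \<Omega>" and "(\<lambda>x. frechet_derivative \<phi> (at x) h) \<in> L2 \<Omega>"
  using bounded_test_function[OF assms(2)] continuous_on_test_function[OF assms(2)]
    L2_bounded_continuous[OF assms(1)] by (metis real_norm_def)+

text \<open>Integration by parts against a constant amounts to the vanishing of the integral of a
  derivative of a test function.\<close>

lemma has_weak_gradient_const:
  assumes "\<Omega> \<in> lmeasurable"
  shows "has_weak_gradient \<Omega> (\<lambda>x. c) (\<lambda>x. 0)"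
proof -
  have "(\<integral>x. frechet_derivative \<phi> (at x) h \<partial>lebesgue_on \<Omega>) = 0" if "\<phi> \<in> test_functions \<Omega>" for \<phi> h
    using that assms by (intro integral_derivative_test_function_on[OF that subset_refl]) auto
  then show ?thesis
    using L2_const[OF assms] by (auto simp: has_weak_gradient_def L2_zero)
qed

lemma has_weak_gradient_add:
  assumes \<Omega>: "\<Omega> \<in> lmeasurable" and f: "has_weak_gradient \<Omega> f f'" and g: "has_weak_gradient \<Omega> g g'"
  shows "has_weak_gradient \<Omega> (\<lambda>x. f x + g x) (\<lambda>x. f' x + g' x)"
proof -
  have L: "f \<in> L2 \<Omega>" "g \<in> L2 \<Omega>" "f' \<in> L2 \<Omega>" "g' \<in> L2 \<Omega>"
    using f g by (auto simp: has_weak_gradient_def)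
  then have L': "(\<lambda>x. f' x $ k) \<in> L2 \<Omega>" "(\<lambda>x. g' x $ k) \<in> L2 \<Omega>" for k
    by (metis vec_L2_iff)+
  have "(\<integral>x. (f x + g x) * frechet_derivative \<phi> (at x) (axis k 1) \<partial>lebesgue_on \<Omega>)
      = - (\<integral>x. (f' x + g' x) $ k * \<phi> x \<partial>lebesgue_on \<Omega>)" if \<phi>: "\<phi> \<in> test_functions \<Omega>" for \<phi> k
  proof -
    let ?d = "\<lambda>x. frechet_derivative \<phi> (at x) (axis k 1)"
    have "integrable (lebesgue_on \<Omega>) (\<lambda>x. f x * ?d x)" "integrable (lebesgue_on \<Omega>) (\<lambda>x. g x * ?d x)"
      "integrable (lebesgue_on \<Omega>) (\<lambda>x. f' x $ k * \<phi> x)" "integrable (lebesgue_on \<Omega>) (\<lambda>x. g' x $ k * \<phi> x)"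
      using integrable_L2_inner[OF L(1) test_function_L2(2)[OF \<Omega> \<phi>]]
        integrable_L2_inner[OF L(2) test_function_L2(2)[OF \<Omega> \<phi>]]
        integrable_L2_inner[OF L'(1) test_function_L2(1)[OF \<Omega> \<phi>]]
        integrable_L2_inner[OF L'(2) test_function_L2(1)[OF \<Omega> \<phi>]] by auto
    then show ?thesis
      using f g \<phi> by (simp add: has_weak_gradient_def distrib_right)
  qed
  then show ?thesis
    using L by (simp add: has_weak_gradient_def L2_add del: vector_add_component)
qed

lemma has_weak_gradient_scaleR:
  assumes "has_weak_gradient \<Omega> f f'"
  shows "has_weak_gradient \<Omega> (\<lambda>x. c * f x) (\<lambda>x. c *\<^sub>R f' x)"
  using assms L2_scaleR[of f \<Omega> c] L2_scaleR[of f' \<Omega> c]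
  by (simp add: has_weak_gradient_def mult.assoc)

lemma has_weak_jacobian_const:
  assumes "\<Omega> \<in> lmeasurable"
  shows "has_weak_jacobian \<Omega> (\<lambda>x. C) (\<lambda>x. 0)"
  using has_weak_gradient_const[OF assms] by (simp add: has_weak_jacobian_def)

lemma has_weak_jacobian_add:
  assumes "\<Omega> \<in> lmeasurable" "has_weak_jacobian \<Omega> v J" "has_weak_jacobian \<Omega> w K"
  shows "has_weak_jacobian \<Omega> (\<lambda>x. v x + w x) (\<lambda>x. J x + K x)"
  using has_weak_gradient_add[OF assms(1)] assms(2,3) by (simp add: has_weak_jacobian_def)

lemma has_weak_jacobian_scaleR:
  assumes "has_weak_jacobian \<Omega> v J"
  shows "has_weak_jacobian \<Omega> (\<lambda>x. c *\<^sub>R v x) (\<lambda>x. c *\<^sub>R J x)"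
  using has_weak_gradient_scaleR assms by (simp add: has_weak_jacobian_def)

lemma has_weak_jacobian_sum:
  assumes "\<Omega> \<in> lmeasurable" "finite I" "\<And>i. i \<in> I \<Longrightarrow> has_weak_jacobian \<Omega> (v i) (J i)"
  shows "has_weak_jacobian \<Omega> (\<lambda>x. \<Sum>i\<in>I. v i x) (\<lambda>x. \<Sum>i\<in>I. J i x)"
  using assms(2,3)
proof (induction I)
  case empty
  then show ?case using has_weak_jacobian_const[OF assms(1), of 0] by simp
next
  case (insert i I)
  then show ?case
    using has_weak_jacobian_add[OF assms(1), of "v i" "J i" "\<lambda>x. \<Sum>i\<in>I. v i x" "\<lambda>x. \<Sum>i\<in>I. J i x"]
    by simp
qed

lemma has_weak_jacobian_L2:
  assumes "has_weak_jacobian \<Omega> v J"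
  shows "v \<in> L2 \<Omega>" and "J \<in> L2 \<Omega>"
  using assms by (auto simp: has_weak_jacobian_def has_weak_gradient_def simp flip: vec_L2_iff[of v] vec_L2_iff[of J])

lemma X1_iff: "w \<in> X1 \<Omega> \<longleftrightarrow> (\<exists>J. has_weak_jacobian \<Omega> w J)"
proof
  assume "w \<in> X1 \<Omega>"
  then obtain G where "\<And>i. has_weak_gradient \<Omega> (\<lambda>x. w x $ i) (G i)"
    unfolding X1_def Sobolev_H1_def by (simp add: choice_iff) metis
  then have "has_weak_jacobian \<Omega> w (\<lambda>x. \<chi> i. G i x)"
    by (simp add: has_weak_jacobian_def)
  then show "\<exists>J. has_weak_jacobian \<Omega> w J" by blast
qed (auto simp: X1_def Sobolev_H1_def has_weak_jacobian_def)

lemma X1_subset_L2: "X1 \<Omega> \<subseteq> L2 \<Omega>"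
  using has_weak_jacobian_L2 by (auto simp: X1_iff)

section \<open>Spaces of functions of time\<close>

lemma in_C_X0_L2: "in_C_X0 \<Omega> T u \<Longrightarrow> t \<in> {0..T} \<Longrightarrow> u t \<in> L2 \<Omega>"
  by (simp add: in_C_X0_def X0_eq_L2)

text \<open>Continuity in time along an arbitrary filter, so that it can be used for each coordinate
  of a point approaching a limit in the square of times.\<close>

lemma tendsto_L2_norm_diff:
  assumes u: "in_C_X0 \<Omega> T u" and s: "s \<in> {0..T}"
    and h: "(h \<longlongrightarrow> s) F" "\<forall>\<^sub>F q in F. h q \<in> {0..T}"
  shows "((\<lambda>q. L2_norm \<Omega> (\<lambda>x. u (h q) x - u s x)) \<longlongrightarrow> 0) F"
proof -
  have "continuous (at s within {0..T}) (\<lambda>t. L2_norm \<Omega> (\<lambda>x. u t x - u s x))"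
    using u s by (simp add: in_C_X0_def continuous_within)
  from continuous_within_tendsto_compose[OF this h(2,1)] show ?thesis by simp
qed

lemma continuous_on_L2_inner_right:
  assumes u: "in_C_X0 \<Omega> T u" and w: "w \<in> L2 \<Omega>"
  shows "continuous_on {0..T} (\<lambda>t. L2_inner \<Omega> (u t) w)"
  unfolding continuous_on_def
proof
  fix s assume s: "s \<in> {0..T}"
  let ?F = "at s within {0..T}"
  have ev: "\<forall>\<^sub>F t in ?F. t \<in> {0..T}" by (simp add: eventually_at_filter)
  have "((\<lambda>t. L2_norm \<Omega> (\<lambda>x. u t x - u s x) * L2_norm \<Omega> w) \<longlongrightarrow> 0 * L2_norm \<Omega> w) ?F"
    by (intro tendsto_mult tendsto_const tendsto_L2_norm_diff[OF u s] ev) (rule tendsto_ident_at)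
  then have "((\<lambda>t. L2_inner \<Omega> (u t) w - L2_inner \<Omega> (u s) w) \<longlongrightarrow> 0) ?F"
  proof (rule Lim_null_comparison[rotated, OF tendsto_eq_rhs])
    show "\<forall>\<^sub>F t in ?F. norm (L2_inner \<Omega> (u t) w - L2_inner \<Omega> (u s) w)
        \<le> L2_norm \<Omega> (\<lambda>x. u t x - u s x) * L2_norm \<Omega> w"
      using ev
    proof eventually_elim
      case (elim t)
      show ?case
        using L2_Cauchy_Schwarz[OF L2_diff[OF in_C_X0_L2[OF u elim] in_C_X0_L2[OF u s]] w]
        by (simp add: L2_inner_diff_left in_C_X0_L2[OF u elim] in_C_X0_L2[OF u s] w)
    qed
  qed simp
  then show "((\<lambda>t. L2_inner \<Omega> (u t) w) \<longlongrightarrow> L2_inner \<Omega> (u s) w) ?F"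
    by (simp add: LIM_zero_iff)
qed

text \<open>Joint continuity of this scalar kernel on a compact square supplies the bound and the
  uniform continuity on which the Riemann sums rest.\<close>

lemma continuous_on_L2_inner:
  assumes u: "in_C_X0 \<Omega> T u"
  shows "continuous_on ({0..T} \<times> {0..T}) (\<lambda>p. L2_inner \<Omega> (u (fst p)) (u (snd p)))"
  unfolding continuous_on_def
proof
  fix p assume p: "p \<in> {0..T} \<times> {0..T}"
  let ?F = "at p within {0..T} \<times> {0..T}"
  define t0 s0 where "t0 = fst p" and "s0 = snd p"
  have t0: "t0 \<in> {0..T}" and s0: "s0 \<in> {0..T}" using p by (auto simp: t0_def s0_def)
  define a :: "real \<times> real \<Rightarrow> real" where "a = (\<lambda>q. L2_norm \<Omega> (\<lambda>x. u (fst q) x - u t0 x))"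
  define b :: "real \<times> real \<Rightarrow> real" where "b = (\<lambda>q. L2_norm \<Omega> (\<lambda>x. u (snd q) x - u s0 x))"
  have L: "u t \<in> L2 \<Omega>" if "t \<in> {0..T}" for t using in_C_X0_L2[OF u that] .
  have ev: "\<forall>\<^sub>F q in ?F. fst q \<in> {0..T}" "\<forall>\<^sub>F q in ?F. snd q \<in> {0..T}"
    by (auto simp: eventually_at_filter intro!: always_eventually)
  have "(a \<longlongrightarrow> 0) ?F" "(b \<longlongrightarrow> 0) ?F"
    unfolding a_def b_def
    by (intro tendsto_L2_norm_diff[OF u] t0 s0 ev;
        simp add: t0_def s0_def tendsto_fst tendsto_snd)+
  \<comment> \<open>The majorant comes from changing one argument at a time: \<open>u t0\<close> is
    replaced while the second argument is kept, whose norm is at most \<open>b q\<close> plus that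
    of \<open>u s0\<close>, and then \<open>u s0\<close> is replaced.\<close>
  then have "((\<lambda>q. a q * (b q + L2_norm \<Omega> (u s0)) + L2_norm \<Omega> (u t0) * b q) \<longlongrightarrow>
      0 * (0 + L2_norm \<Omega> (u s0)) + L2_norm \<Omega> (u t0) * 0) ?F"
    by (intro tendsto_intros)
  then have "((\<lambda>q. L2_inner \<Omega> (u (fst q)) (u (snd q)) - L2_inner \<Omega> (u t0) (u s0)) \<longlongrightarrow> 0) ?F"
  proof (rule Lim_null_comparison[rotated, OF tendsto_eq_rhs])
    show "\<forall>\<^sub>F q in ?F. norm (L2_inner \<Omega> (u (fst q)) (u (snd q)) - L2_inner \<Omega> (u t0) (u s0))
        \<le> a q * (b q + L2_norm \<Omega> (u s0)) + L2_norm \<Omega> (u t0) * b q"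
      using ev
    proof eventually_elim
      case (elim q)
      let ?t = "fst q" and ?s = "snd q"
      note Ls = L[OF elim(1)] L[OF elim(2)] L[OF t0] L[OF s0]
      have "L2_inner \<Omega> (u ?t) (u ?s) - L2_inner \<Omega> (u t0) (u s0)
          = L2_inner \<Omega> (\<lambda>x. u ?t x - u t0 x) (u ?s) + L2_inner \<Omega> (u t0) (\<lambda>x. u ?s x - u s0 x)"
        using Ls by (simp add: L2_inner_diff_left L2_inner_diff_right)
      moreover have "\<bar>L2_inner \<Omega> (\<lambda>x. u ?t x - u t0 x) (u ?s)\<bar> \<le> a q * L2_norm \<Omega> (u ?s)"
        unfolding a_def using Ls by (intro L2_Cauchy_Schwarz L2_diff)
      moreover have "a q * L2_norm \<Omega> (u ?s) \<le> a q * (b q + L2_norm \<Omega> (u s0))"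
        using L2_norm_triangle[OF L2_diff[OF Ls(2,4)] Ls(4)]
        by (intro mult_left_mono) (auto simp: a_def b_def)
      moreover have "\<bar>L2_inner \<Omega> (u t0) (\<lambda>x. u ?s x - u s0 x)\<bar> \<le> L2_norm \<Omega> (u t0) * b q"
        unfolding b_def using Ls by (intro L2_Cauchy_Schwarz L2_diff)
      ultimately show ?case unfolding real_norm_def by linarith
    qed
  qed simp
  then show "((\<lambda>p. L2_inner \<Omega> (u (fst p)) (u (snd p))) \<longlongrightarrow> L2_inner \<Omega> (u (fst p)) (u (snd p))) ?F"
    by (simp add: LIM_zero_iff t0_def s0_def)
qed

lemma continuous_on_L2_norm_power2:
  assumes u: "in_C_X0 \<Omega> T u"
  shows "continuous_on {0..T} (\<lambda>t. (L2_norm \<Omega> (u t))\<^sup>2)"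
proof -
  have "continuous_on {0..T} (\<lambda>t. (t, t))" by (intro continuous_intros)
  from continuous_on_compose2[OF continuous_on_L2_inner[OF u] this]
  show ?thesis by (simp add: L2_norm_power2 image_subset_iff)
qed

section \<open>Adding constants\<close>

lemma in_C_X0_shift:
  assumes "\<Omega> \<in> lmeasurable" "in_C_X0 \<Omega> T u"
  shows "in_C_X0 \<Omega> T (\<lambda>t x. u t x + C)"
  using assms(2) L2_add[OF _ L2_const[OF assms(1)]] by (auto simp: in_C_X0_def X0_eq_L2)

text \<open>Shifting the simple functions by the same constant leaves their distance to the field
  unchanged. Integrability of the squared norm is inherited by correction: it changes by a
  difference of squared \<open>L2\<close> norms, which is continuous in time.\<close>

lemma in_L2_X1_shift:
  assumes \<Omega>: "\<Omega> \<in> lmeasurable" and uC: "in_C_X0 \<Omega> T u" and u: "in_L2_X1 \<Omega> T u J"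
  shows "in_L2_X1 \<Omega> T (\<lambda>t x. u t x + C) J"
proof -
  let ?M = "lebesgue_on {0..T}"
  have jac: "has_weak_jacobian \<Omega> (\<lambda>x. v x + C) K" if "has_weak_jacobian \<Omega> v K" for v K
    using has_weak_jacobian_add[OF \<Omega> that has_weak_jacobian_const[OF \<Omega>, of C]] by simp
  obtain s where s: "\<And>n. simple_function ?M (s n)"
    "\<And>n t. t \<in> {0..T} \<Longrightarrow> has_weak_jacobian \<Omega> (fst (s n t)) (snd (s n t))"
    "AE t in ?M. (\<lambda>n. X1_norm \<Omega> (\<lambda>x. fst (s n t) x - u t x) (\<lambda>x. snd (s n t) x - J t x)) \<longlonglongrightarrow> 0"
    using u unfolding in_L2_X1_def by blast
  define s' where "s' = (\<lambda>n t. (\<lambda>x. fst (s n t) x + C, snd (s n t)))"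
  have "simple_function ?M (s' n)" for n
    unfolding s'_def by (rule simple_function_compose1[OF s(1)])
  moreover have "has_weak_jacobian \<Omega> (fst (s' n t)) (snd (s' n t))" if "t \<in> {0..T}" for n t
    using jac[OF s(2)[OF that]] by (simp add: s'_def)
  moreover have "AE t in ?M. (\<lambda>n. X1_norm \<Omega> (\<lambda>x. fst (s' n t) x - (u t x + C)) (\<lambda>x. snd (s' n t) x - J t x)) \<longlonglongrightarrow> 0"
    using s(3) by (simp add: s'_def)
  moreover have "AE t in ?M. has_weak_jacobian \<Omega> (\<lambda>x. u t x + C) (J t)"
    using u jac unfolding in_L2_X1_def by (auto elim: eventually_mono)
  moreover have "integrable ?M (\<lambda>t. (X1_norm \<Omega> (\<lambda>x. u t x + C) (J t))\<^sup>2)"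
  proof -
    have "integrable ?M (\<lambda>t. (X1_norm \<Omega> (u t) (J t))\<^sup>2
        + ((L2_norm \<Omega> (\<lambda>x. u t x + C))\<^sup>2 - (L2_norm \<Omega> (u t))\<^sup>2))"
      using u continuous_on_L2_norm_power2[OF uC] continuous_on_L2_norm_power2[OF in_C_X0_shift[OF \<Omega> uC]]
      by (intro Bochner_Integration.integrable_add[OF _ continuous_imp_integrable_real] continuous_on_diff)
         (auto simp: in_L2_X1_def)
    then show ?thesis by (simp add: X1_norm_def add.commute)
  qed
  ultimately show ?thesis unfolding in_L2_X1_def by blast
qed

text \<open>The shift adds to the left-hand side the pairing of C with w times the integral of the
  derivative of \<psi>, which is zero; hence the same \<open>du\<close> serves.\<close>

lemma has_time_derivative_shift:
  assumes \<Omega>: "\<Omega> \<in> lmeasurable" and uC: "in_C_X0 \<Omega> T u" and u: "has_time_derivative \<Omega> T u du"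
  shows "has_time_derivative \<Omega> T (\<lambda>t x. u t x + C) du"
proof -
  let ?M = "lebesgue_on {0..T}"
  have "(\<integral>t. (\<integral>x. (u t x + C) \<bullet> w x \<partial>lebesgue_on \<Omega>) * deriv \<psi> t \<partial>?M)
      = (\<integral>t. (\<integral>x. u t x \<bullet> w x \<partial>lebesgue_on \<Omega>) * deriv \<psi> t \<partial>?M)"
    if "w \<in> X1 \<Omega>" and \<psi>: "\<psi> \<in> test_functions {0<..<T}" for w \<psi>
  proof -
    have w: "w \<in> L2 \<Omega>" using that(1) X1_subset_L2 by blast
    let ?c = "L2_inner \<Omega> (\<lambda>x. C) w"
    have d: "deriv \<psi> = (\<lambda>t. frechet_derivative \<psi> (at t) 1)"
    proof
      fix t
      have "(\<psi> has_derivative frechet_derivative \<psi> (at t)) (at t)"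
        by (rule has_derivative_test_function[OF \<psi>])
      moreover have "frechet_derivative \<psi> (at t) s = frechet_derivative \<psi> (at t) 1 * s" for s
        using linear_scale[OF has_derivative_linear[OF calculation], of s 1] by simp
      then have "frechet_derivative \<psi> (at t) = (*) (frechet_derivative \<psi> (at t) 1)" by (rule ext)
      ultimately have "(\<psi> has_real_derivative frechet_derivative \<psi> (at t) 1) (at t)"
        unfolding has_field_derivative_def by metis
      then show "deriv \<psi> t = frechet_derivative \<psi> (at t) 1" by (rule DERIV_imp_deriv)
    qed
    have cont: "continuous_on {0..T} (deriv \<psi>)"
      unfolding d by (rule continuous_on_test_function[OF \<psi>])
    have i1: "integrable ?M (\<lambda>t. L2_inner \<Omega> (u t) w * deriv \<psi> t)"
      by (intro continuous_imp_integrable_real continuous_on_mult cont continuous_on_L2_inner_right[OF uC w])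
    have i2: "integrable ?M (\<lambda>t. ?c * deriv \<psi> t)"
      by (intro continuous_imp_integrable_real continuous_on_mult cont continuous_on_const)
    have "(\<integral>t. deriv \<psi> t \<partial>?M) = 0"
      unfolding d by (rule integral_derivative_test_function_on[OF \<psi>]) auto
    then have "(\<integral>t. L2_inner \<Omega> (u t) w * deriv \<psi> t \<partial>?M)
        = (\<integral>t. L2_inner \<Omega> (u t) w * deriv \<psi> t + ?c * deriv \<psi> t \<partial>?M)"
      using i1 i2 by simp
    also have "\<dots> = (\<integral>t. L2_inner \<Omega> (\<lambda>x. u t x + C) w * deriv \<psi> t \<partial>?M)"
      using in_C_X0_L2[OF uC] w L2_const[OF \<Omega>, of C]
      by (intro Bochner_Integration.integral_cong refl) (simp add: L2_inner_add_left distrib_right)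
    finally show ?thesis by (simp add: L2_inner_def)
  qed
  then show ?thesis using u by (simp add: has_time_derivative_def)
qed

text \<open>Invariance of \<open>D\<close> makes the weak formulation for the shifted field
  literally that of u, with the same Jacobian and the same time derivative.\<close>

lemma weak_solution_shift:
  assumes \<Omega>: "\<Omega> \<in> lmeasurable" and D: "\<And>y. D (y + C) = D y"
    and u: "weak_solution \<Omega> D T u0 u"
  shows "weak_solution \<Omega> D T (\<lambda>x. u0 x + C) (\<lambda>t x. u t x + C)"
proof -
  have uC: "in_C_X0 \<Omega> T u" using u by (simp add: weak_solution_def)
  obtain J du where J: "in_L2_X1 \<Omega> T u J" "has_time_derivative \<Omega> T u du"
    "AE t in lebesgue_on {0..T}. \<forall>w Jw. has_weak_jacobian \<Omega> w Jw \<longrightarrow>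
       du t w + (\<integral>x. trace (transpose (Jw x) ** D (u t x) ** J t x) \<partial>lebesgue_on \<Omega>) = 0"
    using u by (auto simp: weak_solution_def)
  show ?thesis
    unfolding weak_solution_def D
  proof (intro conjI exI)
    show "AE x in lebesgue_on \<Omega>. u 0 x + C = u0 x + C"
      using u by (simp add: weak_solution_def)
  qed (fact in_C_X0_shift[OF \<Omega> uC] in_L2_X1_shift[OF \<Omega> uC J(1)]
      has_time_derivative_shift[OF \<Omega> uC J(2)] J(3))+
qed

text \<open>A competitor for the shifted datum becomes, after subtraction of C, a solution for
  \<open>u0\<close>. This is why invariance under -C is used along with invariance under C.\<close>

lemma unique_weak_solution_shift:
  assumes \<Omega>: "\<Omega> \<in> lmeasurable" and D: "\<And>y C. D (y + C) = D y"
    and u: "unique_weak_solution \<Omega> D T u0 u"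
  shows "unique_weak_solution \<Omega> D T (\<lambda>x. u0 x + C) (\<lambda>t x. u t x + C)"
  unfolding unique_weak_solution_def
proof (intro conjI allI impI ballI)
  show "weak_solution \<Omega> D T (\<lambda>x. u0 x + C) (\<lambda>t x. u t x + C)"
    using u by (intro weak_solution_shift[OF \<Omega>] D) (simp add: unique_weak_solution_def)
  fix v s assume v: "weak_solution \<Omega> D T (\<lambda>x. u0 x + C) v" and s: "s \<in> {0..T}"
  have "weak_solution \<Omega> D T (\<lambda>x. u0 x + C + - C) (\<lambda>t x. v t x + - C)"
    by (rule weak_solution_shift[OF \<Omega> _ v]) (rule D)
  then have "weak_solution \<Omega> D T u0 (\<lambda>t x. v t x + - C)" by simp
  with u s have "AE x in lebesgue_on \<Omega>. v s x + - C = u s x"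
    by (auto simp: unique_weak_solution_def)
  then show "AE x in lebesgue_on \<Omega>. v s x = u s x + C"
    by (auto elim!: eventually_mono simp: algebra_simps)
qed

lemma X0_class_shift:
  assumes "\<Omega> \<in> lmeasurable"
  shows "X0_class \<Omega> (\<lambda>x. f x + C) = class_shift C (X0_class \<Omega> f)"
proof -
  have shift: "(\<lambda>x. g x + c) \<in> X0_class \<Omega> (\<lambda>x. f x + c)" if "g \<in> X0_class \<Omega> f" for f g c
    using that L2_add[OF _ L2_const[OF assms]] by (auto simp: X0_class_def X0_eq_L2)
  have "g \<in> class_shift C (X0_class \<Omega> f)" if "g \<in> X0_class \<Omega> (\<lambda>x. f x + C)" for g
    unfolding class_shift_def
    using shift[OF that, of "- C"] by (intro image_eqI[of _ _ "\<lambda>x. g x + - C"]) auto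
  with shift show ?thesis by (auto simp: class_shift_def)
qed

text \<open>One inclusion for arbitrary datum and constant is enough: the other one is its instance
  for the shifted datum and -C. It is shown class by class in the union over time horizons and
  solutions.\<close>

lemma scale_space_shift:
  assumes \<Omega>: "\<Omega> \<in> lmeasurable" and D: "\<And>y C. D (y + C) = D y"
  shows "scale_space \<Omega> D t (\<lambda>x. u0 x + C) = class_shift C (scale_space \<Omega> D t u0)"
proof -
  have sub: "class_shift c (scale_space \<Omega> D t u1) \<subseteq> scale_space \<Omega> D t (\<lambda>x. u1 x + c)" for c u1
  proof -
    have "(\<lambda>x. f x + c) \<in> scale_space \<Omega> D t (\<lambda>x. u1 x + c)"
      if "f \<in> X0_class \<Omega> (u t)" "0 < T" "t \<le> T" "unique_weak_solution \<Omega> D T u1 u" for f T u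
    proof -
      have "(\<lambda>x. f x + c) \<in> X0_class \<Omega> (\<lambda>x. u t x + c)"
        using that(1) unfolding X0_class_shift[OF \<Omega>] class_shift_def by blast
      moreover have "unique_weak_solution \<Omega> D T (\<lambda>x. u1 x + c) (\<lambda>t x. u t x + c)"
        by (rule unique_weak_solution_shift[OF \<Omega> _ that(4)]) (rule D)
      ultimately show ?thesis
        unfolding scale_space_def using that(2,3)
        by (intro UnionI[of "X0_class \<Omega> (\<lambda>x. u t x + c)"] CollectI exI[of _ T]
            exI[of _ "\<lambda>t x. u t x + c"]) auto
    qed
    then show ?thesis by (auto simp: class_shift_def scale_space_def[of _ _ _ u1])
  qed
  have "g \<in> class_shift C (scale_space \<Omega> D t u0)" if "g \<in> scale_space \<Omega> D t (\<lambda>x. u0 x + C)" for g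
  proof -
    have "(\<lambda>x. g x + - C) \<in> scale_space \<Omega> D t u0"
      using sub[of "- C" "\<lambda>x. u0 x + C"] that by (auto simp: class_shift_def)
    then show ?thesis
      unfolding class_shift_def by (intro image_eqI[of _ _ "\<lambda>x. g x + - C"]) auto
  qed
  with sub show ?thesis by blast
qed

section \<open>Approximation by simple functions\<close>

text \<open>Completeness of Lebesgue measure: a limit that exists only almost everywhere still gives
  a measurable function.\<close>

lemma borel_measurable_lebesgue_on_AE:
  fixes f g :: "'a::euclidean_space \<Rightarrow> 'b::euclidean_space"
  assumes f: "f \<in> borel_measurable (lebesgue_on S)" and S: "S \<in> sets lebesgue"
    and ae: "AE x in lebesgue_on S. f x = g x"
  shows "g \<in> borel_measurable (lebesgue_on S)"
proof (rule borel_measurable_if_D)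
  have "AE x in lebesgue. x \<in> S \<longrightarrow> f x = g x"
    using ae S by (simp add: AE_restrict_space_iff)
  then have "AE x in lebesgue. (if x \<in> S then f x else 0) = (if x \<in> S then g x else 0)"
    by (auto elim: eventually_mono)
  then show "(\<lambda>x. if x \<in> S then g x else 0) \<in> borel_measurable lebesgue"
    by (rule borel_measurable_AE[OF borel_measurable_if_I[OF f S]])
qed

lemma X1_norm_nonneg [simp]: "0 \<le> X1_norm \<Omega> w J"
  by (simp add: X1_norm_def)

lemma L2_norm_le_X1_norm: "L2_norm \<Omega> w \<le> X1_norm \<Omega> w J" "L2_norm \<Omega> J \<le> X1_norm \<Omega> w J"
  by (auto simp: X1_norm_def intro: real_sqrt_sum_squares_ge1 real_sqrt_sum_squares_ge2)

lemma X1_norm_triangle: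
  assumes "v \<in> L2 \<Omega>" "w \<in> L2 \<Omega>" "J \<in> L2 \<Omega>" "K \<in> L2 \<Omega>"
  shows "X1_norm \<Omega> (\<lambda>x. v x + w x) (\<lambda>x. J x + K x) \<le> X1_norm \<Omega> v J + X1_norm \<Omega> w K"
proof -
  have "X1_norm \<Omega> (\<lambda>x. v x + w x) (\<lambda>x. J x + K x)
      \<le> sqrt ((L2_norm \<Omega> v + L2_norm \<Omega> w)\<^sup>2 + (L2_norm \<Omega> J + L2_norm \<Omega> K)\<^sup>2)"
    unfolding X1_norm_def using assms
    by (intro real_sqrt_le_mono add_mono power_mono L2_norm_triangle) auto
  also have "\<dots> \<le> X1_norm \<Omega> v J + X1_norm \<Omega> w K"
    unfolding X1_norm_def by (rule real_sqrt_sum_squares_triangle_ineq)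
  finally show ?thesis .
qed

lemma X1_norm_diff_triangle:
  assumes "u \<in> L2 \<Omega>" "v \<in> L2 \<Omega>" "w \<in> L2 \<Omega>" "I \<in> L2 \<Omega>" "J \<in> L2 \<Omega>" "K \<in> L2 \<Omega>"
  shows "X1_norm \<Omega> (\<lambda>x. u x - w x) (\<lambda>x. I x - K x)
    \<le> X1_norm \<Omega> (\<lambda>x. u x - v x) (\<lambda>x. I x - J x) + X1_norm \<Omega> (\<lambda>x. v x - w x) (\<lambda>x. J x - K x)"
  using X1_norm_triangle[of "\<lambda>x. u x - v x" \<Omega> "\<lambda>x. v x - w x" "\<lambda>x. I x - J x" "\<lambda>x. J x - K x"]
  by (simp add: assms L2_diff)

lemma X1_norm_minus_commute:
  "X1_norm \<Omega> (\<lambda>x. v x - w x) (\<lambda>x. J x - K x) = X1_norm \<Omega> (\<lambda>x. w x - v x) (\<lambda>x. K x - J x)"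
  by (simp only: X1_norm_def L2_norm_minus_commute[of \<Omega> v w] L2_norm_minus_commute[of \<Omega> J K])

text \<open>The definition of \<open>in_L2_X1\<close> provides convergence almost everywhere only.
  Truncation makes the simple functions dominated by a multiple of the norm of u, and dominated
  convergence turns this into convergence of the integrated distance.\<close>

lemma in_L2_X1_simple_approximation:
  assumes u: "in_L2_X1 \<Omega> T u J" and \<Omega>: "\<Omega> \<in> lmeasurable"
  obtains \<sigma> where
    "\<And>n. simple_function (lebesgue_on {0..T}) (\<sigma> n)"
    "\<And>n t. t \<in> {0..T} \<Longrightarrow> has_weak_jacobian \<Omega> (fst (\<sigma> n t)) (snd (\<sigma> n t))"
    "\<And>n. integrable (lebesgue_on {0..T})
       (\<lambda>t. X1_norm \<Omega> (\<lambda>x. fst (\<sigma> n t) x - u t x) (\<lambda>x. snd (\<sigma> n t) x - J t x))"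
    "(\<lambda>n. \<integral>t. X1_norm \<Omega> (\<lambda>x. fst (\<sigma> n t) x - u t x) (\<lambda>x. snd (\<sigma> n t) x - J t x) \<partial>lebesgue_on {0..T})
       \<longlonglongrightarrow> 0"
proof -
  let ?M = "lebesgue_on {0..T}"
  interpret M: finite_measure ?M by (rule finite_measure_lebesgue_on) simp
  define N where "N = (\<lambda>t. X1_norm \<Omega> (u t) (J t))"
  obtain s where s: "\<And>n. simple_function ?M (s n)"
    "\<And>n t. t \<in> {0..T} \<Longrightarrow> has_weak_jacobian \<Omega> (fst (s n t)) (snd (s n t))"
    "AE t in ?M. (\<lambda>n. X1_norm \<Omega> (\<lambda>x. fst (s n t) x - u t x) (\<lambda>x. snd (s n t) x - J t x)) \<longlonglongrightarrow> 0"
    using u unfolding in_L2_X1_def by blast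
  have iN2: "integrable ?M (\<lambda>t. (N t)\<^sup>2)" using u by (simp add: in_L2_X1_def N_def)
  have "(\<lambda>t. sqrt ((N t)\<^sup>2)) \<in> borel_measurable ?M" using iN2 by measurable
  then have mN: "N \<in> borel_measurable ?M" by (simp add: N_def)
  have iN: "integrable ?M N"
  proof (rule Bochner_Integration.integrable_bound)
    show "integrable ?M (\<lambda>t. 1 + (N t)\<^sup>2)" using iN2 by simp
    have "norm (N t) \<le> norm (1 + (N t)\<^sup>2)" for t
    proof -
      have "0 \<le> N t" by (simp add: N_def)
      with sum_squares_bound[of "N t" 1] show ?thesis by simp
    qed
    then show "AE t in ?M. norm (N t) \<le> norm (1 + (N t)\<^sup>2)" by simp
  qed (rule mN)
  define X where "X = (\<lambda>p q :: field2 \<times> jacobian2. X1_norm \<Omega> (\<lambda>x. fst p x - fst q x) (\<lambda>x. snd p x - snd q x))"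
  define z :: "field2 \<times> jacobian2" where "z = (\<lambda>x. 0, \<lambda>x. 0)"
  define p where "p = (\<lambda>t. (u t, J t))"
  \<comment> \<open>Truncation never increases the distance to u. Where it acts, the new distance is
    \<open>N t\<close>, whereas a pair of norm above \<open>2 * N t\<close> is further than
    \<open>N t\<close> from u by the triangle inequality.\<close>
  define \<sigma> where "\<sigma> = (\<lambda>n t. if X (s n t) z \<le> 2 * N t then s n t else z)"
  define ok where "ok = (\<lambda>q :: field2 \<times> jacobian2. fst q \<in> L2 \<Omega> \<and> snd q \<in> L2 \<Omega>)"
  have tri: "X a c \<le> X a b + X b c" if "ok a" "ok b" "ok c" for a b c
    using that unfolding X_def ok_def by (intro X1_norm_diff_triangle) auto
  have sym: "X a b = X b a" for a b
    unfolding X_def by (rule X1_norm_minus_commute)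
  have Xnn: "0 \<le> X a b" for a b by (simp add: X_def)
  have Np: "N t = X (p t) z" for t by (simp add: N_def X_def p_def z_def)
  have okz: "ok z" by (simp add: ok_def z_def L2_zero)
  have oks: "ok (s n t)" if "t \<in> {0..T}" for n t
    using has_weak_jacobian_L2[OF s(2)[OF that]] by (simp add: ok_def)
  have ok\<sigma>: "ok (\<sigma> n t)" if "t \<in> {0..T}" for n t
    using oks[OF that] okz by (simp add: \<sigma>_def)
  have okp: "AE t in ?M. ok (p t)"
    using u unfolding in_L2_X1_def ok_def p_def
    by (auto elim!: eventually_mono dest: has_weak_jacobian_L2)
  have space: "AE t in ?M. t \<in> {0..T}" by (rule AE_I2) simp
  have simple: "simple_function ?M (\<sigma> n)" for n
    unfolding \<sigma>_def
  proof (rule simple_function_If[OF s(1) simple_function_const])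
    have [measurable]: "(\<lambda>t. X (s n t) z) \<in> borel_measurable ?M"
      by (rule borel_measurable_simple_function[OF simple_function_compose1[OF s(1)]])
    note [measurable] = mN
    show "{t \<in> space ?M. X (s n t) z \<le> 2 * N t} \<in> sets ?M" by measurable
  qed
  have conv: "AE t in ?M. (\<lambda>n. X (\<sigma> n t) (p t)) \<longlonglongrightarrow> 0"
    using s(3) okp space
  proof eventually_elim
    case (elim t)
    have le: "X (\<sigma> n t) (p t) \<le> X (s n t) (p t)" for n
    proof (cases "X (s n t) z \<le> 2 * N t")
      case False
      then have "X (\<sigma> n t) (p t) = N t" by (simp add: \<sigma>_def Np sym[of z])
      moreover have "X (s n t) z \<le> X (s n t) (p t) + N t"
        unfolding Np using elim by (intro tri oks okz) auto
      ultimately show ?thesis using False by linarith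
    qed (simp add: \<sigma>_def)
    have "norm (X (\<sigma> n t) (p t)) \<le> X (s n t) (p t)" for n
      using le[of n] Xnn by simp
    moreover have "(\<lambda>n. X (s n t) (p t)) \<longlonglongrightarrow> 0"
      using elim(1) by (simp add: X_def p_def)
    ultimately show ?case
      by (rule Lim_null_comparison[OF always_eventually[OF allI]])
  qed
  have dom: "AE t in ?M. norm (X (\<sigma> n t) (p t)) \<le> 3 * N t" for n
    using okp space
  proof eventually_elim
    case (elim t)
    have "X (\<sigma> n t) (p t) \<le> X (\<sigma> n t) z + X z (p t)"
      using elim by (intro tri ok\<sigma> okz) auto
    moreover have "X (\<sigma> n t) z \<le> 2 * N t"
      by (auto simp: \<sigma>_def X_def N_def L2_norm_zero X1_norm_def[of _ "\<lambda>x. 0"] z_def)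
    ultimately show ?case using Xnn by (simp add: Np sym[of z])
  qed
  \<comment> \<open>Measurability of the distance to u is obtained as a limit: the distance between
    two simple functions takes finitely many values on measurable sets, and it converges as the
    second one tends to u.\<close>
  have meas: "(\<lambda>t. X (\<sigma> n t) (p t)) \<in> borel_measurable ?M" for n
  proof (rule borel_measurable_lebesgue_on_AE)
    show "(\<lambda>t. lim (\<lambda>m. X (\<sigma> n t) (\<sigma> m t))) \<in> borel_measurable ?M"
      by (intro borel_measurable_lim_metric borel_measurable_simple_function
          simple_function_compose2[OF simple simple])
    show "AE t in ?M. lim (\<lambda>m. X (\<sigma> n t) (\<sigma> m t)) = X (\<sigma> n t) (p t)"
      using conv okp space
    proof eventually_elim
      case (elim t)
      have "\<bar>X (\<sigma> n t) (\<sigma> m t) - X (\<sigma> n t) (p t)\<bar> \<le> X (\<sigma> m t) (p t)" for m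
        using tri[OF ok\<sigma>[OF elim(3), of n] ok\<sigma>[OF elim(3), of m] elim(2)]
          tri[OF ok\<sigma>[OF elim(3), of n] elim(2) ok\<sigma>[OF elim(3), of m]]
        by (auto simp: sym[of "p t"])
      then have "(\<lambda>m. X (\<sigma> n t) (\<sigma> m t) - X (\<sigma> n t) (p t)) \<longlonglongrightarrow> 0"
        by (intro Lim_null_comparison[OF always_eventually[OF allI] elim(1)]) simp
      then show ?case by (intro limI) (simp add: LIM_zero_iff)
    qed
  qed simp
  have Xeq: "X (\<sigma> n t) (p t) = X1_norm \<Omega> (\<lambda>x. fst (\<sigma> n t) x - u t x) (\<lambda>x. snd (\<sigma> n t) x - J t x)" for n t
    by (simp add: X_def p_def)
  show thesis
  proof (rule that[of \<sigma>])
    show "simple_function ?M (\<sigma> n)" for n by (rule simple)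
    show "has_weak_jacobian \<Omega> (fst (\<sigma> n t)) (snd (\<sigma> n t))" if "t \<in> {0..T}" for n t
      using s(2)[OF that] has_weak_jacobian_const[OF \<Omega>, of 0] by (simp add: \<sigma>_def z_def)
    have i3: "integrable ?M (\<lambda>t. 3 * N t)" using iN by simp
    have "(\<lambda>n. \<integral>t. X (\<sigma> n t) (p t) \<partial>?M) \<longlonglongrightarrow> (\<integral>t. 0 \<partial>?M)"
      by (rule integral_dominated_convergence[where w = "\<lambda>t. 3 * N t"]) (use meas i3 conv dom in auto)
    then show "(\<lambda>n. \<integral>t. X1_norm \<Omega> (\<lambda>x. fst (\<sigma> n t) x - u t x) (\<lambda>x. snd (\<sigma> n t) x - J t x) \<partial>?M) \<longlonglongrightarrow> 0"
      by (simp add: Xeq)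
    have "integrable ?M (\<lambda>t. X (\<sigma> n t) (p t))" for n
      by (rule Bochner_Integration.integrable_bound[OF i3 meas])
         (use dom[of n] in \<open>auto elim!: eventually_mono\<close>)
    then show "integrable ?M (\<lambda>t. X1_norm \<Omega> (\<lambda>x. fst (\<sigma> n t) x - u t x) (\<lambda>x. snd (\<sigma> n t) x - J t x))" for n
      by (simp add: Xeq)
  qed
qed

section \<open>Uniqueness for constant coefficients\<close>

text \<open>Each cell of length h contributes at most e h, by comparing f with its value at the left
  end point. Left end points match sums over j < k, which involve only times before
  \<open>k * h\<close>.\<close>

lemma riemann_sum_error:
  fixes f :: "real \<Rightarrow> real"
  assumes f: "continuous_on {0..T} f" and "0 \<le> h" and kT: "real k * h \<le> T"
    and osc: "\<And>x y. x \<in> {0..T} \<Longrightarrow> y \<in> {0..T} \<Longrightarrow> \<bar>x - y\<bar> \<le> h \<Longrightarrow> \<bar>f x - f y\<bar> \<le> e"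
  shows "\<bar>(\<Sum>j<k. h * f (real j * h)) - integral {0..real k * h} f\<bar> \<le> real k * h * e"
  using kT
proof (induction k)
  case (Suc k)
  let ?a = "real k * h" and ?b = "real (Suc k) * h"
  have ab: "0 \<le> ?a" "?a \<le> ?b" "?b \<le> T" "?b - ?a = h" "?a \<le> T"
    using Suc.prems \<open>0 \<le> h\<close> by (auto simp: algebra_simps)
  have sub: "{?a..?b} \<subseteq> {0..T}" "{0..?b} \<subseteq> {0..T}"
    using ab by (meson atLeastatMost_subset_iff order_refl)+
  have cont: "continuous_on {?a..?b} f" by (rule continuous_on_subset[OF f sub(1)])
  have int: "f integrable_on {?a..?b}" "f integrable_on {0..?b}"
    by (intro integrable_continuous_interval continuous_on_subset[OF f] sub)+
  have "norm (integral {?a..?b} (\<lambda>x. f x - f ?a)) \<le> e * (?b - ?a)"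
  proof (rule integral_bound[OF ab(2)])
    fix x assume x: "x \<in> {?a..?b}"
    have "x \<in> {0..T}" using x sub(1) by blast
    moreover have "?a \<in> {0..T}" using ab by (meson atLeastAtMost_iff)
    moreover have "\<bar>x - ?a\<bar> \<le> h"
      using x ab(4) unfolding atLeastAtMost_iff by linarith
    ultimately show "norm (f x - f ?a) \<le> e" using osc by simp
  qed (intro continuous_intros cont)
  also have "integral {?a..?b} (\<lambda>x. f x - f ?a) = integral {?a..?b} f - h * f ?a"
    by (subst Henstock_Kurzweil_Integration.integral_diff[OF int(1) integrable_const_ivl])
       (use ab(2,4) in simp)
  finally have 1: "\<bar>integral {?a..?b} f - h * f ?a\<bar> \<le> e * h" using ab by simp
  have 2: "integral {0..?b} f = integral {0..?a} f + integral {?a..?b} f"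
    using Henstock_Kurzweil_Integration.integral_combine[OF ab(1,2) int(2)] by simp
  have 3: "\<bar>(\<Sum>j<k. h * f (real j * h)) - integral {0..?a} f\<bar> \<le> ?a * e"
    using Suc.IH ab by simp
  have "?b * e = ?a * e + e * h" by (simp add: algebra_simps)
  with 1 2 3 show ?case by simp
qed simp

text \<open>Riemann sums replace the primitive \<open>\<integral>\<^sub>0\<^sup>t u\<close>, so that no integral of fields is needed.\<close>

lemma vanishes_if_primitive_dissipative:
  assumes u: "in_C_X0 \<Omega> T u" and "T > 0"
    and diss: "\<And>t. t \<in> {0<..T} \<Longrightarrow> integral {0..t} (\<lambda>r. L2_inner \<Omega> (u t) (u r)) \<le> 0"
    and t0: "t0 \<in> {0..T}"
  shows "L2_norm \<Omega> (u t0) = 0"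
proof -
  define F where "F = (\<lambda>t r. L2_inner \<Omega> (u t) (u r))"
  have L: "u t \<in> L2 \<Omega>" if "t \<in> {0..T}" for t using in_C_X0_L2[OF u that] .
  have contF: "continuous_on ({0..T} \<times> {0..T}) (\<lambda>p. F (fst p) (snd p))"
    unfolding F_def by (rule continuous_on_L2_inner[OF u])
  have contFt: "continuous_on {0..T} (F t)" if "t \<in> {0..T}" for t
    unfolding F_def L2_inner_commute[of \<Omega> "u t"] by (rule continuous_on_L2_inner_right[OF u L[OF that]])
  have comp: "compact ({0..T} \<times> {0..T})" by (intro compact_Times compact_Icc)
  then have "bounded ((\<lambda>p. F (fst p) (snd p)) ` ({0..T} \<times> {0..T}))"
    by (intro compact_imp_bounded compact_continuous_image contF)
  then obtain B where "\<forall>p\<in>{0..T} \<times> {0..T}. \<bar>F (fst p) (snd p)\<bar> \<le> B"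
    by (auto simp: bounded_iff)
  then have B: "\<bar>F t r\<bar> \<le> B" if "t \<in> {0..T}" "r \<in> {0..T}" for t r
    using that by auto
  have "B \<ge> 0" using B[OF t0 t0] by linarith
  \<comment> \<open>The Riemann sum \<open>V N\<close> stands for the primitive at time s. A
    discrete energy estimate bounds its norm by a multiple of the square root of e, and its pairing
    with \<open>u t0\<close> approximates the integral here.\<close>
  have small: "\<bar>integral {0..s} (F t0)\<bar> \<le> sqrt B * sqrt ((2 * T * T + T) * e) + T * e"
    if s: "s \<in> {0<..T}" and "e > 0" for s e
  proof -
    have "uniformly_continuous_on ({0..T} \<times> {0..T}) (\<lambda>p. F (fst p) (snd p))"
      by (rule compact_uniformly_continuous[OF contF comp])
    then obtain d where d: "d > 0" "\<And>p q. p \<in> {0..T} \<times> {0..T} \<Longrightarrow> q \<in> {0..T} \<times> {0..T} \<Longrightarrow>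
        dist q p < d \<Longrightarrow> dist (F (fst q) (snd q)) (F (fst p) (snd p)) < e"
      using \<open>e > 0\<close> unfolding uniformly_continuous_on_def by metis
    \<comment> \<open>Two demands on the mesh width h: below \<open>d\<close> it controls the
      oscillation of \<open>F\<close>, and h B \<le> e makes the quadratic term of each energy step
      small. Adding 1 to \<open>B\<close> avoids a division by zero.\<close>
    define d' where "d' = min d (e / (B + 1))"
    have "d' > 0" using d(1) \<open>e > 0\<close> \<open>B \<ge> 0\<close> by (simp add: d'_def)
    then obtain N where N: "N > 0" "inverse (real N) < d' / s"
      using s reals_Archimedean[of "d' / s"] by (metis divide_pos_pos greaterThanAtMost_iff zero_less_Suc)
    define h where "h = s / real N"
    have h: "0 < h" "h < d" "h * B \<le> e" "real N * h = s"
    proof -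
      show "0 < h" "real N * h = s" using N(1) s by (auto simp: h_def)
      have "h < d'" using N(2) s by (simp add: h_def field_simps)
      then show "h < d" by (simp add: d'_def)
      have "h * (B + 1) \<le> e" using \<open>h < d'\<close> \<open>B \<ge> 0\<close> by (simp add: d'_def field_simps)
      with \<open>0 < h\<close> show "h * B \<le> e" by (simp add: distrib_left)
    qed
    have osc: "\<bar>F t x - F t y\<bar> \<le> e"
      if "t \<in> {0..T}" "x \<in> {0..T}" "y \<in> {0..T}" "\<bar>x - y\<bar> \<le> h" for t x y
      using d(2)[of "(t, y)" "(t, x)"] that h(2) by (auto simp: dist_Pair_Pair dist_real_def)
    have le_T: "real k * h \<le> T" if "k \<le> N" for k
    proof -
      have "real k * h \<le> real N * h" using that h(1) by (intro mult_right_mono) auto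
      then show ?thesis using h(4) s by simp
    qed
    then have grid: "real k * h \<in> {0..T}" if "k \<le> N" for k
      using that h(1) by simp
    have sum: "\<bar>(\<Sum>j<k. h * F t (real j * h)) - integral {0..real k * h} (F t)\<bar> \<le> T * e"
      if "t \<in> {0..T}" "k \<le> N" for t k
    proof -
      have "\<bar>(\<Sum>j<k. h * F t (real j * h)) - integral {0..real k * h} (F t)\<bar> \<le> real k * h * e"
        by (rule riemann_sum_error[OF contFt]) (use that h(1) le_T osc in auto)
      also have "\<dots> \<le> T * e" using le_T[OF that(2)] \<open>e > 0\<close> by (intro mult_right_mono) auto
      finally show ?thesis .
    qed
    define V where "V = (\<lambda>k x. \<Sum>j<k. h *\<^sub>R u (real j * h) x)"
    have VL: "V k \<in> L2 \<Omega>" if "k \<le> N" for k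
      unfolding V_def using that by (intro L2_sum L2_scaleR L grid) auto
    have FV: "L2_inner \<Omega> (u t) (V k) = (\<Sum>j<k. h * F t (real j * h))"
      if "t \<in> {0..T}" "k \<le> N" for t k
      unfolding V_def F_def using that
      by (subst L2_inner_sum_right) (auto intro!: L2_scaleR L grid simp: L2_inner_scaleR_right)
    \<comment> \<open>One step adds h (2 p + h q) to the squared norm, where p pairs
      \<open>u\<close> at the grid time with \<open>V k\<close> and q is the squared norm of
      \<open>u\<close> there. Dissipation gives p \<le> T e up to the error of the Riemann sum, and
      h q \<le> e by the choice of h.\<close>
    have VV: "(L2_norm \<Omega> (V k))\<^sup>2 \<le> real k * (h * (2 * (T * e) + e))" if "k \<le> N" for k
      using that
    proof (induction k)
      case 0
      then show ?case by (simp add: V_def)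
    next
      case (Suc k)
      let ?t = "real k * h"
      have t: "?t \<in> {0..T}" using Suc.prems by (intro grid) auto
      have "V (Suc k) = (\<lambda>x. V k x + h *\<^sub>R u ?t x)" by (simp add: V_def fun_eq_iff)
      then have "(L2_norm \<Omega> (V (Suc k)))\<^sup>2
          = (L2_norm \<Omega> (V k))\<^sup>2 + 2 * L2_inner \<Omega> (V k) (\<lambda>x. h *\<^sub>R u ?t x) + (L2_norm \<Omega> (\<lambda>x. h *\<^sub>R u ?t x))\<^sup>2"
        using L2_norm_add_power2[OF VL L2_scaleR[OF L[OF t]]] Suc.prems by simp
      also have "\<dots> = (L2_norm \<Omega> (V k))\<^sup>2 + h * (2 * L2_inner \<Omega> (u ?t) (V k) + h * F ?t ?t)"
        by (simp only: L2_norm_power2[of \<Omega> "\<lambda>x. h *\<^sub>R u ?t x"] L2_inner_scaleR_right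
            L2_inner_scaleR_left F_def L2_inner_commute[of \<Omega> "V k"]) (simp add: algebra_simps)
      also have "\<dots> \<le> real k * (h * (2 * (T * e) + e)) + h * (2 * (T * e) + e)"
      proof (intro add_mono mult_left_mono)
        show "(L2_norm \<Omega> (V k))\<^sup>2 \<le> real k * (h * (2 * (T * e) + e))"
          using Suc by simp
        have "integral {0..?t} (F ?t) \<le> 0"
        \<comment> \<open>Dissipation is assumed at positive times only; at the first grid point the
          integral is over a single point.\<close>
        proof (cases "?t = 0")
          case False
          with t have "?t \<in> {0<..T}" unfolding atLeastAtMost_iff greaterThanAtMost_iff by linarith
          then show ?thesis unfolding F_def by (rule diss)
        qed auto
        then show "L2_inner \<Omega> (u ?t) (V k) \<le> T * e"
          using sum[OF t, of k] FV[OF t, of k] Suc.prems by simp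
        have "h * F ?t ?t \<le> h * B" using B[OF t t] h(1) by (intro mult_left_mono) auto
        with h(3) show "h * F ?t ?t \<le> e" by simp
      qed (use h(1) in auto)
      finally show ?case by (simp add: algebra_simps)
    qed
    have "(L2_norm \<Omega> (V N))\<^sup>2 \<le> s * (2 * (T * e) + e)"
      using VV[OF order_refl] h(4) by (simp flip: mult.assoc)
    also have "\<dots> \<le> T * (2 * (T * e) + e)"
      using s \<open>T > 0\<close> \<open>e > 0\<close> by (intro mult_right_mono) auto
    also have "\<dots> = (2 * T * T + T) * e" by (simp add: algebra_simps)
    finally have VN: "L2_norm \<Omega> (V N) \<le> sqrt ((2 * T * T + T) * e)"
      by (rule real_le_rsqrt)
    have "L2_norm \<Omega> (u t0) \<le> sqrt B"
      using B[OF t0 t0] by (intro real_le_rsqrt) (simp add: L2_norm_power2 F_def)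
    then have "L2_norm \<Omega> (u t0) * L2_norm \<Omega> (V N) \<le> sqrt B * sqrt ((2 * T * T + T) * e)"
      using VN \<open>B \<ge> 0\<close> by (intro mult_mono) auto
    then have "\<bar>L2_inner \<Omega> (u t0) (V N)\<bar> \<le> sqrt B * sqrt ((2 * T * T + T) * e)"
      using L2_Cauchy_Schwarz[OF L[OF t0] VL[OF order_refl]] by linarith
    then show ?thesis
      using sum[OF t0 order_refl] FV[OF t0 order_refl] h(4) by simp
  qed
  have zero: "integral {0..s} (F t0) = 0" if "s \<in> {0..T}" for s
  proof (cases "s = 0")
    case False
    with that have s: "s \<in> {0<..T}" by auto
    have "((\<lambda>e. sqrt B * sqrt ((2 * T * T + T) * e) + T * e) \<longlongrightarrow>
        sqrt B * sqrt ((2 * T * T + T) * 0) + T * 0) (at_right 0)"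
      by (intro tendsto_intros)
    then have "\<bar>integral {0..s} (F t0)\<bar> \<le> sqrt B * sqrt ((2 * T * T + T) * 0) + T * 0"
    proof (rule tendsto_lowerbound)
      show "\<forall>\<^sub>F e in at_right 0. \<bar>integral {0..s} (F t0)\<bar> \<le> sqrt B * sqrt ((2 * T * T + T) * e) + T * e"
        unfolding eventually_at_filter using small[OF s] by (auto intro!: always_eventually)
    qed simp
    then show ?thesis by simp
  qed simp
  \<comment> \<open>The integral of \<open>F t0\<close> from 0 to s vanishes for every s, so its
    derivative at s = \<open>t0\<close>, the squared norm of \<open>u t0\<close>, is zero. At an end
    point of the interval the derivative is one-sided.\<close>
  have "((\<lambda>s. 0) has_vector_derivative F t0 t0) (at t0 within {0..T})"
    by (rule has_vector_derivative_transform[OF t0 _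
        integral_has_vector_derivative[OF contFt[OF t0] t0]]) (simp add: zero)
  moreover have "((\<lambda>s. 0) has_vector_derivative (0::real)) (at t0 within {0..T})"
    by simp
  ultimately have "F t0 t0 = 0"
    using vector_derivative_unique_within_closed_interval[of 0 T t0 "\<lambda>s. 0" "F t0 t0" 0] t0 \<open>T > 0\<close>
    by auto
  then show ?thesis by (simp add: F_def L2_norm_eq_inner)
qed

section \<open>The trace form as an inner product of matrices, and its coercivity\<close>

lemma trace_transpose_mult:
  fixes W A V :: "real^'n^'n"
  shows "trace (transpose W ** A ** V) = W \<bullet> (A ** V)"
proof -
  have "trace (transpose W ** B) = W \<bullet> B" for B :: "real^'n^'n"
    unfolding trace_def matrix_matrix_mult_def transpose_def inner_vec_def
    by (simp add: sum.swap[of "\<lambda>i k. W $ k $ i * B $ k $ i"])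
  then show ?thesis by (simp flip: matrix_mul_assoc)
qed

lemma inner_eq_sum_columns:
  fixes V W :: "real^'n^'n"
  shows "V \<bullet> W = (\<Sum>k\<in>UNIV. column k V \<bullet> column k W)"
  unfolding inner_vec_def column_def by (simp add: sum.swap[of "\<lambda>i k. V $ i $ k * W $ i $ k"])

text \<open>\<open>A\<close> acts on the columns of \<open>V\<close>, which for a Jacobian are the
  partial derivatives of the field. Coercivity on vectors is applied to each column; the squared
  columns add up to the squared norm of the matrix.\<close>

lemma matrix_coercive:
  fixes A V :: "real^'n^'n"
  assumes "\<And>\<xi>. \<alpha> * (norm \<xi>)\<^sup>2 \<le> \<xi> \<bullet> (A *v \<xi>)"
  shows "\<alpha> * (norm V)\<^sup>2 \<le> V \<bullet> (A ** V)"
proof -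
  have "column k (A ** V) = A *v column k V" for k
    by (simp add: column_def matrix_matrix_mult_def matrix_vector_mult_def vec_eq_iff)
  moreover have "\<alpha> * (norm V)\<^sup>2 = (\<Sum>k\<in>UNIV. \<alpha> * (norm (column k V))\<^sup>2)"
    by (simp add: power2_norm_eq_inner inner_eq_sum_columns[of V V] sum_distrib_left)
  ultimately show ?thesis
    unfolding inner_eq_sum_columns[of V "A ** V"] by (simp add: sum_mono assms)
qed

lemma linear_matrix_mult: "linear (\<lambda>V :: real^'k^'n. (A :: real^'n^'m) ** V)"
  by (rule linearI)
     (simp_all add: matrix_matrix_mult_def vec_eq_iff sum_distrib_left sum.distrib algebra_simps)

lemma L2_norm_linear_image_le:
  fixes f :: "real^2 \<Rightarrow> 'b::euclidean_space" and h :: "'b \<Rightarrow> 'c::euclidean_space"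
  assumes f: "f \<in> L2 \<Omega>" and h: "linear h" "\<And>y. norm (h y) \<le> c * norm y" and "0 \<le> c"
  shows "L2_norm \<Omega> (\<lambda>x. h (f x)) \<le> c * L2_norm \<Omega> f"
proof -
  have "(\<integral>x. (norm (h (f x)))\<^sup>2 \<partial>lebesgue_on \<Omega>) \<le> (\<integral>x. c\<^sup>2 * (norm (f x))\<^sup>2 \<partial>lebesgue_on \<Omega>)"
  proof (rule integral_mono)
    show "integrable (lebesgue_on \<Omega>) (\<lambda>x. (norm (h (f x)))\<^sup>2)"
      using L2_linear_image[OF f h(1)] by (simp add: L2_def)
    show "integrable (lebesgue_on \<Omega>) (\<lambda>x. c\<^sup>2 * (norm (f x))\<^sup>2)"
      using f by (simp add: L2_def)
    show "(norm (h (f x)))\<^sup>2 \<le> c\<^sup>2 * (norm (f x))\<^sup>2" for x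
      using power_mono[OF h(2) norm_ge_zero, of "f x" 2] by (simp add: power_mult_distrib)
  qed
  also have "\<dots> = c\<^sup>2 * (\<integral>x. (norm (f x))\<^sup>2 \<partial>lebesgue_on \<Omega>)" by simp
  finally show ?thesis
    unfolding L2_norm_def using \<open>0 \<le> c\<close>
    by (metis abs_of_nonneg real_sqrt_abs real_sqrt_le_mono real_sqrt_mult)
qed

text \<open>The weights of the finite sum are the same for every \<open>l\<close>. This lets a time
  integral of pairings be read as the pairing with one finite linear combination of fields.\<close>

lemma integral_compose_simple_function:
  fixes \<sigma> :: "'a \<Rightarrow> 'c" and l :: "'c \<Rightarrow> real"
  assumes \<sigma>: "simple_function M \<sigma>" and M: "finite_measure M" and I: "I \<in> sets M"
  shows "integrable M (\<lambda>r. indicator I r * l (\<sigma> r))"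
    and "(\<integral>r. indicator I r * l (\<sigma> r) \<partial>M)
      = (\<Sum>p\<in>\<sigma> ` space M. measure M (I \<inter> (\<sigma> -` {p} \<inter> space M)) * l p)"
proof -
  let ?E = "\<lambda>p. I \<inter> (\<sigma> -` {p} \<inter> space M)"
  have fin: "finite (\<sigma> ` space M)" using \<sigma> by (rule simple_functionD)
  have E: "?E p \<in> sets M" for p using I simple_functionD(2)[OF \<sigma>] by auto
  have eq: "indicator I r * l (\<sigma> r) = (\<Sum>p\<in>\<sigma> ` space M. indicator (?E p) r * l p)"
    if r: "r \<in> space M" for r
  proof -
    have "(\<Sum>p\<in>\<sigma> ` space M. indicator (?E p) r * l p)
        = (\<Sum>p\<in>\<sigma> ` space M. if p = \<sigma> r then indicator I r * l (\<sigma> r) else 0)"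
      using r by (intro sum.cong) (auto simp: indicator_def)
    then show ?thesis using r fin by simp
  qed
  have int: "integrable M (\<lambda>r. indicator (?E p) r * l p)" for p
    using E finite_measure.emeasure_finite[OF M] by (intro integrable_mult_left integrable_real_indicator)
      (auto simp: less_top)
  have "integrable M (\<lambda>r. \<Sum>p\<in>\<sigma> ` space M. indicator (?E p) r * l p)"
    using int by (intro Bochner_Integration.integrable_sum)
  then show "integrable M (\<lambda>r. indicator I r * l (\<sigma> r))"
    by (subst Bochner_Integration.integrable_cong[OF refl eq])
  have "(\<integral>r. indicator I r * l (\<sigma> r) \<partial>M) = (\<integral>r. (\<Sum>p\<in>\<sigma> ` space M. indicator (?E p) r * l p) \<partial>M)"
    by (rule Bochner_Integration.integral_cong[OF refl eq])
  also have "\<dots> = (\<Sum>p\<in>\<sigma> ` space M. \<integral>r. indicator (?E p) r * l p \<partial>M)"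
    using int by (intro Bochner_Integration.integral_sum)
  also have "\<dots> = (\<Sum>p\<in>\<sigma> ` space M. measure M (?E p) * l p)"
    using E sets.sets_into_space[OF E] by (intro sum.cong refl) (simp add: Int_absorb2)
  finally show "(\<integral>r. indicator I r * l (\<sigma> r) \<partial>M) = (\<Sum>p\<in>\<sigma> ` space M. measure M (?E p) * l p)" .
qed

text \<open>
  Under the integral defining the primitive, \<open>u\<close> is replaced by simple functions, so that the test
  function is a finite linear combination of fields in \<open>X\<^sub>1\<close>. The error is quadratic in the distance
  after absorbing the gradient of the test function by coercivity.
\<close>

lemma weak_solution_primitive_dissipative:
  assumes \<Omega>: "\<Omega> \<in> lmeasurable" and \<alpha>: "\<alpha> > 0" and A: "\<And>\<xi>. \<alpha> * (norm \<xi>)\<^sup>2 \<le> \<xi> \<bullet> (A *v \<xi>)"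
    and sol: "weak_solution \<Omega> (\<lambda>_. A) T (\<lambda>_. 0) u" and t: "t \<in> {0<..T}"
  shows "integral {0..t} (\<lambda>r. L2_inner \<Omega> (u t) (u r)) \<le> 0"
proof -
  let ?M = "lebesgue_on {0..T}" and ?I = "indicator {0<..<t} :: real \<Rightarrow> real"
  have M: "finite_measure ?M" by (rule finite_measure_lebesgue_on) simp
  have I: "{0<..<t} \<in> sets ?M" using t by (auto simp: sets_restrict_space_iff)
  have tT: "t \<in> {0..T}" using t by auto
  have uC: "in_C_X0 \<Omega> T u" using sol by (simp add: weak_solution_def)
  note uL = in_C_X0_L2[OF uC] and utL = in_C_X0_L2[OF uC tT]
  obtain J du where J: "in_L2_X1 \<Omega> T u J" and du: "has_time_derivative \<Omega> T u du"
    and eq: "AE r in ?M. \<forall>w W. has_weak_jacobian \<Omega> w W \<longrightarrow>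
      du r w + (\<integral>x. trace (transpose (W x) ** A ** J r x) \<partial>lebesgue_on \<Omega>) = 0"
    using sol unfolding weak_solution_def by blast
  have JL: "AE r in ?M. J r \<in> L2 \<Omega>"
    using J unfolding in_L2_X1_def by (auto elim!: eventually_mono dest: has_weak_jacobian_L2)
  obtain c where c: "c > 0" "\<And>V :: real^2^2. norm (A ** V) \<le> c * norm V"
    using linear_bounded_pos[OF linear_matrix_mult[of A]] by blast
  have AL: "(\<lambda>x. A ** V x) \<in> L2 \<Omega>" if "V \<in> L2 \<Omega>" for V :: jacobian2
    by (rule L2_linear_image[OF that linear_matrix_mult])
  have ALn: "L2_norm \<Omega> (\<lambda>x. A ** V x) \<le> c * L2_norm \<Omega> V" if "V \<in> L2 \<Omega>" for V :: jacobian2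
    by (rule L2_norm_linear_image_le[OF that linear_matrix_mult c(2)]) (use c(1) in simp)
  \<comment> \<open>For fixed \<open>w\<close> the pairing with \<open>u t\<close> is continuous in
    time, so the distributional derivative integrates up to every \<open>t\<close>; the zero initial
    datum removes the contribution at time 0.\<close>
  have pairing: "(\<integral>r. ?I r * du r w \<partial>?M) = L2_inner \<Omega> (u t) w"
    and du_int: "integrable ?M (\<lambda>r. du r w)" if w: "w \<in> X1 \<Omega>" for w
  proof -
    have wL: "w \<in> L2 \<Omega>" using w X1_subset_L2 by blast
    show int: "integrable ?M (\<lambda>r. du r w)"
      using du w by (simp add: has_time_derivative_def)
    have "AE x in lebesgue_on \<Omega>. u 0 x \<bullet> w x = 0"
      using sol by (auto simp: weak_solution_def elim: eventually_mono)
    then have "L2_inner \<Omega> (u 0) w = 0"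
      unfolding L2_inner_def by (rule integral_eq_zero_AE)
    moreover have "(\<integral>r. ?I r * du r w \<partial>?M) = L2_inner \<Omega> (u t) w - L2_inner \<Omega> (u 0) w"
      by (rule integral_weak_derivative[OF continuous_on_L2_inner_right[OF uC wL] int])
         (use du w t in \<open>auto simp: has_time_derivative_def L2_inner_def\<close>)
    ultimately show "(\<integral>r. ?I r * du r w \<partial>?M) = L2_inner \<Omega> (u t) w" by simp
  qed
  obtain \<sigma> where \<sigma>: "\<And>n. simple_function ?M (\<sigma> n)"
    and \<sigma>jac: "\<And>n r. r \<in> {0..T} \<Longrightarrow> has_weak_jacobian \<Omega> (fst (\<sigma> n r)) (snd (\<sigma> n r))"
    and eint: "\<And>n. integrable ?M (\<lambda>r. X1_norm \<Omega> (\<lambda>x. fst (\<sigma> n r) x - u r x) (\<lambda>x. snd (\<sigma> n r) x - J r x))"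
    and elim0: "(\<lambda>n. \<integral>r. X1_norm \<Omega> (\<lambda>x. fst (\<sigma> n r) x - u r x) (\<lambda>x. snd (\<sigma> n r) x - J r x) \<partial>?M)
       \<longlonglongrightarrow> 0"
    by (rule in_L2_X1_simple_approximation[OF J \<Omega>]) blast
  define e where "e = (\<lambda>n r. X1_norm \<Omega> (\<lambda>x. fst (\<sigma> n r) x - u r x) (\<lambda>x. snd (\<sigma> n r) x - J r x))"
  define \<epsilon> where "\<epsilon> = (\<lambda>n. \<integral>r. e n r \<partial>?M)"
  have e_int: "integrable ?M (e n)" for n unfolding e_def by (rule eint)
  have \<epsilon>0: "\<epsilon> \<longlonglongrightarrow> 0" unfolding \<epsilon>_def e_def by (rule elim0)
  have ind_int: "integrable ?M (\<lambda>r. ?I r * f r)" if "integrable ?M f" for f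
    using integrable_mult_indicator[OF I that] by simp
  have ind_le: "(\<integral>r. ?I r * f r \<partial>?M) \<le> C * \<epsilon> n"
    if f: "integrable ?M (\<lambda>r. ?I r * f r)" and le: "AE r in ?M. f r \<le> C * e n r" and "0 \<le> C" for f C n
  proof -
    have "(\<integral>r. ?I r * f r \<partial>?M) \<le> (\<integral>r. C * e n r \<partial>?M)"
    proof (rule integral_mono_AE[OF f integrable_mult_right[OF e_int]])
      show "AE r in ?M. ?I r * f r \<le> C * e n r"
        using le
      proof eventually_elim
        case (elim r)
        have "0 \<le> C * e n r" using \<open>0 \<le> C\<close> by (simp add: e_def)
        with elim show ?case by (simp add: indicator_def)
      qed
    qed
    then show ?thesis by (simp add: \<epsilon>_def)
  qed
  define \<Phi> where "\<Phi> = (\<integral>r. ?I r * L2_inner \<Omega> (u t) (u r) \<partial>?M)"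
  have F_int: "integrable ?M (\<lambda>r. L2_inner \<Omega> (u t) (u r))"
    unfolding L2_inner_commute[of \<Omega> "u t"]
    by (intro continuous_imp_integrable_real continuous_on_L2_inner_right[OF uC] uL tT)
  have bound: "\<Phi> \<le> L2_norm \<Omega> (u t) * \<epsilon> n + (c * \<epsilon> n)\<^sup>2 / (4 * \<alpha>)" for n
  proof -
    let ?R = "\<sigma> n ` space ?M"
    \<comment> \<open>The time that the simple function spends at the value p before
      \<open>t\<close>. With these weights \<open>U\<close> and \<open>W\<close> are the integrals
      from 0 to \<open>t\<close> of its two components, and \<open>U\<close> is an admissible test
      field with Jacobian \<open>W\<close>.\<close>
    define \<mu> where "\<mu> = (\<lambda>p. measure ?M ({0<..<t} \<inter> (\<sigma> n -` {p} \<inter> space ?M)))"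
    define U where "U = (\<lambda>x. \<Sum>p\<in>?R. \<mu> p *\<^sub>R fst p x)"
    define W where "W = (\<lambda>x. \<Sum>p\<in>?R. \<mu> p *\<^sub>R snd p x)"
    note simple_int = integral_compose_simple_function[OF \<sigma>[of n] M I]
    have jac: "has_weak_jacobian \<Omega> (fst p) (snd p)" if "p \<in> ?R" for p
      using that \<sigma>jac by auto
    have UW: "has_weak_jacobian \<Omega> U W"
      unfolding U_def W_def using simple_functionD(1)[OF \<sigma>]
      by (intro has_weak_jacobian_sum[OF \<Omega>] has_weak_jacobian_scaleR jac)
    note pL = has_weak_jacobian_L2[OF jac]
    note WL = has_weak_jacobian_L2(2)[OF UW]
    have U1: "U \<in> X1 \<Omega>" using UW X1_iff by blast
    have uU: "L2_inner \<Omega> (u t) U = (\<integral>r. ?I r * L2_inner \<Omega> (u t) (fst (\<sigma> n r)) \<partial>?M)"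
      unfolding U_def simple_int(2)[of "\<lambda>p. L2_inner \<Omega> (u t) (fst p)"]
      by (subst L2_inner_sum_right) (simp_all add: L2_scaleR pL utL L2_inner_scaleR_right \<mu>_def)
    have AW: "A ** W x = (\<Sum>p\<in>?R. \<mu> p *\<^sub>R (A ** snd p x))" for x
      unfolding W_def by (simp add: linear_sum[OF linear_matrix_mult] linear_scale[OF linear_matrix_mult])
    have WAW: "L2_inner \<Omega> W (\<lambda>x. A ** W x) = (\<integral>r. ?I r * L2_inner \<Omega> W (\<lambda>x. A ** snd (\<sigma> n r) x) \<partial>?M)"
      unfolding AW simple_int(2)[of "\<lambda>p. L2_inner \<Omega> W (\<lambda>x. A ** snd p x)"]
      by (subst L2_inner_sum_right) (simp_all add: L2_scaleR AL pL WL L2_inner_scaleR_right \<mu>_def)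
    \<comment> \<open>The equation at time r is tested with the fixed field \<open>U\<close>. It
      involves \<open>J r\<close> where the simple approximation is wanted; the exchange costs at
      most \<open>c * e n r\<close> times the norm of \<open>W\<close>.\<close>
    have "L2_inner \<Omega> (u t) U + L2_inner \<Omega> W (\<lambda>x. A ** W x)
        = (\<integral>r. ?I r * (du r U + L2_inner \<Omega> W (\<lambda>x. A ** snd (\<sigma> n r) x)) \<partial>?M)"
      unfolding WAW pairing[OF U1, symmetric] distrib_left
      by (intro Bochner_Integration.integral_add[symmetric] ind_int du_int U1
          simple_int(1)[of "\<lambda>p. L2_inner \<Omega> W (\<lambda>x. A ** snd p x)"])
    also have "\<dots> \<le> (L2_norm \<Omega> W * c) * \<epsilon> n"
    proof (rule ind_le)
      show "integrable ?M (\<lambda>r. ?I r * (du r U + L2_inner \<Omega> W (\<lambda>x. A ** snd (\<sigma> n r) x)))"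
        unfolding distrib_left
        by (intro Bochner_Integration.integrable_add ind_int du_int U1
            simple_int(1)[of "\<lambda>p. L2_inner \<Omega> W (\<lambda>x. A ** snd p x)"])
      have space: "AE r in ?M. r \<in> {0..T}" by (rule AE_I2) simp
      show "AE r in ?M. du r U + L2_inner \<Omega> W (\<lambda>x. A ** snd (\<sigma> n r) x) \<le> (L2_norm \<Omega> W * c) * e n r"
        using eq JL space
      proof eventually_elim
        case (elim r)
        have sL: "snd (\<sigma> n r) \<in> L2 \<Omega>" by (rule has_weak_jacobian_L2[OF \<sigma>jac[OF elim(3)]])
        let ?d = "\<lambda>x. snd (\<sigma> n r) x - J r x"
        have dL: "?d \<in> L2 \<Omega>" by (rule L2_diff[OF sL elim(2)])
        have "du r U = - L2_inner \<Omega> W (\<lambda>x. A ** J r x)"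
          using elim(1) UW unfolding L2_inner_def trace_transpose_mult by (simp add: eq_neg_iff_add_eq_0)
        then have "du r U + L2_inner \<Omega> W (\<lambda>x. A ** snd (\<sigma> n r) x) = L2_inner \<Omega> W (\<lambda>x. A ** ?d x)"
          using L2_inner_diff_right[OF AL[OF sL] AL[OF elim(2)] WL]
          by (simp add: linear_diff[OF linear_matrix_mult])
        also have "\<dots> \<le> L2_norm \<Omega> W * L2_norm \<Omega> (\<lambda>x. A ** ?d x)"
          using L2_Cauchy_Schwarz[OF WL AL[OF dL]] by simp
        also have "\<dots> \<le> L2_norm \<Omega> W * (c * e n r)"
        proof (rule mult_left_mono)
          have "c * L2_norm \<Omega> ?d \<le> c * e n r"
            unfolding e_def using c(1) by (intro mult_left_mono L2_norm_le_X1_norm) auto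
          with ALn[OF dL] show "L2_norm \<Omega> (\<lambda>x. A ** ?d x) \<le> c * e n r" by linarith
        qed simp
        finally show ?case by (simp add: mult.assoc)
      qed
    qed (use c(1) in simp)
    finally have 1: "L2_inner \<Omega> (u t) U + L2_inner \<Omega> W (\<lambda>x. A ** W x) \<le> L2_norm \<Omega> W * (c * \<epsilon> n)"
      by (simp add: mult.assoc)
    have "\<alpha> * (L2_norm \<Omega> W)\<^sup>2 = (\<integral>x. \<alpha> * (norm (W x))\<^sup>2 \<partial>lebesgue_on \<Omega>)"
      by (simp add: L2_norm_def)
    also have "\<dots> \<le> L2_inner \<Omega> W (\<lambda>x. A ** W x)"
      unfolding L2_inner_def
      by (intro integral_mono integrable_L2_inner AL WL matrix_coercive A)
         (use WL in \<open>simp add: L2_def\<close>)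
    finally have 2: "\<alpha> * (L2_norm \<Omega> W)\<^sup>2 \<le> L2_inner \<Omega> W (\<lambda>x. A ** W x)" .
    \<comment> \<open>Completing the square: the error is linear in the norm of \<open>W\<close>,
      which has no bound uniform in n at hand, and is absorbed by the coercive term, leaving a
      remainder independent of \<open>W\<close>.\<close>
    have "0 \<le> (2 * \<alpha> * L2_norm \<Omega> W - c * \<epsilon> n)\<^sup>2 / (4 * \<alpha>)" using \<alpha> by simp
    also have "\<dots> = \<alpha> * (L2_norm \<Omega> W)\<^sup>2 - L2_norm \<Omega> W * (c * \<epsilon> n) + (c * \<epsilon> n)\<^sup>2 / (4 * \<alpha>)"
      using \<alpha> by (simp add: field_simps power2_eq_square)
    finally have 3: "L2_inner \<Omega> (u t) U \<le> (c * \<epsilon> n)\<^sup>2 / (4 * \<alpha>)" using 1 2 by linarith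
    \<comment> \<open>Return from the approximate to the true primitive; here the error is linear in
      \<open>\<epsilon> n\<close>, with the fixed factor
      \<open>L2_norm \<Omega> (u t)\<close>.\<close>
    have "\<Phi> - L2_inner \<Omega> (u t) U
        = (\<integral>r. ?I r * (L2_inner \<Omega> (u t) (u r) - L2_inner \<Omega> (u t) (fst (\<sigma> n r))) \<partial>?M)"
      unfolding \<Phi>_def uU right_diff_distrib
      by (intro Bochner_Integration.integral_diff[symmetric] ind_int F_int
          simple_int(1)[of "\<lambda>p. L2_inner \<Omega> (u t) (fst p)"])
    also have "\<dots> \<le> L2_norm \<Omega> (u t) * \<epsilon> n"
    proof (rule ind_le)
      show "integrable ?M (\<lambda>r. ?I r * (L2_inner \<Omega> (u t) (u r) - L2_inner \<Omega> (u t) (fst (\<sigma> n r))))"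
        unfolding right_diff_distrib
        by (intro Bochner_Integration.integrable_diff ind_int F_int
          simple_int(1)[of "\<lambda>p. L2_inner \<Omega> (u t) (fst p)"])
      show "AE r in ?M. L2_inner \<Omega> (u t) (u r) - L2_inner \<Omega> (u t) (fst (\<sigma> n r)) \<le> L2_norm \<Omega> (u t) * e n r"
      proof (rule AE_I2)
        fix r assume "r \<in> space ?M"
        then have r: "r \<in> {0..T}" by simp
        have sL: "fst (\<sigma> n r) \<in> L2 \<Omega>" by (rule has_weak_jacobian_L2[OF \<sigma>jac[OF r]])
        have "L2_inner \<Omega> (u t) (u r) - L2_inner \<Omega> (u t) (fst (\<sigma> n r))
            = L2_inner \<Omega> (u t) (\<lambda>x. u r x - fst (\<sigma> n r) x)"
          using L2_inner_diff_right[OF uL[OF r] sL utL] by simp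
        also have "\<dots> \<le> L2_norm \<Omega> (u t) * L2_norm \<Omega> (\<lambda>x. u r x - fst (\<sigma> n r) x)"
          using L2_Cauchy_Schwarz[OF utL L2_diff[OF uL[OF r] sL]] by simp
        also have "\<dots> \<le> L2_norm \<Omega> (u t) * e n r"
          unfolding e_def L2_norm_minus_commute[of \<Omega> "u r"]
          by (intro mult_left_mono L2_norm_le_X1_norm) simp
        finally show "L2_inner \<Omega> (u t) (u r) - L2_inner \<Omega> (u t) (fst (\<sigma> n r)) \<le> L2_norm \<Omega> (u t) * e n r" .
      qed
    qed simp
    finally show ?thesis using 3 by linarith
  qed
  have "(\<lambda>n. L2_norm \<Omega> (u t) * \<epsilon> n + (c * \<epsilon> n)\<^sup>2 / (4 * \<alpha>)) \<longlonglongrightarrow>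
      L2_norm \<Omega> (u t) * 0 + (c * 0)\<^sup>2 / (4 * \<alpha>)"
    using \<alpha> by (intro tendsto_intros \<epsilon>0) simp
  then have "\<Phi> \<le> L2_norm \<Omega> (u t) * 0 + (c * 0)\<^sup>2 / (4 * \<alpha>)"
    by (rule LIMSEQ_le_const) (use bound in blast)
  then have "\<Phi> \<le> 0" by simp
  moreover have "\<Phi> = integral {0..t} (\<lambda>r. L2_inner \<Omega> (u t) (u r))"
  proof -
    have "\<Phi> = integral {0..T} (\<lambda>r. ?I r * L2_inner \<Omega> (u t) (u r))"
      unfolding \<Phi>_def by (rule lebesgue_integral_eq_integral[OF ind_int[OF F_int]]) simp
    also have "\<dots> = integral {0..T} (\<lambda>r. if r \<in> {0<..<t} then L2_inner \<Omega> (u t) (u r) else 0)"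
      by (rule arg_cong[where f = "integral {0..T}"]) (auto simp: indicator_def)
    also have "\<dots> = integral {0<..<t} (\<lambda>r. L2_inner \<Omega> (u t) (u r))"
      by (subst integral_restrict_Int) (use t in \<open>auto intro!: arg_cong2[where f = integral]\<close>)
    finally show ?thesis by (simp add: integral_open_interval_real)
  qed
  ultimately show ?thesis by simp
qed

section \<open>The zero initial datum\<close>

lemma weak_solution_zero:
  assumes "\<Omega> \<in> lmeasurable"
  shows "weak_solution \<Omega> D T (\<lambda>_. 0) (\<lambda>_ _. 0)"
proof -
  have C: "in_C_X0 \<Omega> T (\<lambda>_ _. 0)"
    by (simp add: in_C_X0_def X0_eq_L2 L2_zero)
  have X1_0: "X1_norm \<Omega> (\<lambda>x. 0) (\<lambda>x. 0) = 0"
    by (simp add: X1_norm_def)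
  have J: "in_L2_X1 \<Omega> T (\<lambda>_ _. 0) (\<lambda>_ _. 0)"
    unfolding in_L2_X1_def
    using has_weak_jacobian_const[OF assms, of 0]
    by (intro conjI exI[of _ "\<lambda>_ _. (\<lambda>x. 0, \<lambda>x. 0)"]) (simp_all add: X1_0)
  have du: "has_time_derivative \<Omega> T (\<lambda>_ _. 0) (\<lambda>_ _. 0)"
    by (simp add: has_time_derivative_def in_X1_dual_def exI[of _ 0])
  have "trace (transpose W ** B ** (0 :: real^2^2)) = 0" for W B :: "real^2^2"
    by (simp add: trace_def)
  with C J du show ?thesis
    unfolding weak_solution_def
    by (intro conjI exI[of _ "\<lambda>_ _. 0"]) auto
qed

lemma unique_weak_solution_zero:
  assumes \<Omega>: "\<Omega> \<in> lmeasurable" and \<alpha>: "\<alpha> > 0" and A: "\<And>\<xi>. \<alpha> * (norm \<xi>)\<^sup>2 \<le> \<xi> \<bullet> (A *v \<xi>)"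
    and "T > 0"
  shows "unique_weak_solution \<Omega> (\<lambda>_. A) T (\<lambda>_. 0) (\<lambda>_ _. 0)"
  unfolding unique_weak_solution_def
proof (intro conjI allI impI ballI)
  fix v s assume v: "weak_solution \<Omega> (\<lambda>_. A) T (\<lambda>_. 0) v" and s: "s \<in> {0..T}"
  have vC: "in_C_X0 \<Omega> T v" using v by (simp add: weak_solution_def)
  have "L2_norm \<Omega> (v s) = 0"
    by (rule vanishes_if_primitive_dissipative[OF vC \<open>T > 0\<close> _ s])
       (rule weak_solution_primitive_dissipative[OF \<Omega> \<alpha> A v])
  then show "AE x in lebesgue_on \<Omega>. v s x = 0"
    by (rule L2_norm_eq_0_imp_AE[OF in_C_X0_L2[OF vC s]])
qed (rule weak_solution_zero[OF \<Omega>])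

text \<open>The zero solution on a horizon reaching beyond \<open>t\<close> gives one inclusion; t +
  1 is positive even for t = 0. Uniqueness gives the other: every admissible horizon and solution
  contributes the same class.\<close>

lemma scale_space_zero:
  assumes \<Omega>: "\<Omega> \<in> lmeasurable" and \<alpha>: "\<alpha> > 0" and A: "\<And>\<xi>. \<alpha> * (norm \<xi>)\<^sup>2 \<le> \<xi> \<bullet> (A *v \<xi>)"
    and t: "t \<ge> 0"
  shows "scale_space \<Omega> (\<lambda>_. A) t (\<lambda>_. 0) = X0_class \<Omega> (\<lambda>_. 0)"
proof
  note unique = unique_weak_solution_zero[OF \<Omega> \<alpha> A]
  show "X0_class \<Omega> (\<lambda>_. 0) \<subseteq> scale_space \<Omega> (\<lambda>_. A) t (\<lambda>_. 0)"
    unfolding scale_space_def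
    using unique[of "t + 1"] t
    by (intro Union_upper CollectI exI[of _ "t + 1"] exI[of _ "\<lambda>_ _. 0"]) auto
  have "X0_class \<Omega> (u t) \<subseteq> X0_class \<Omega> (\<lambda>_. 0)"
    if "0 < T" "t \<le> T" "unique_weak_solution \<Omega> (\<lambda>_. A) T (\<lambda>_. 0) u" for T u
  proof -
    have "AE x in lebesgue_on \<Omega>. u t x = 0"
      using unique[OF that(1)] that t by (auto simp: unique_weak_solution_def)
    then show ?thesis by (auto simp: X0_class_def elim: eventually_elim2)
  qed
  then show "scale_space \<Omega> (\<lambda>_. A) t (\<lambda>_. 0) \<subseteq> X0_class \<Omega> (\<lambda>_. 0)"
    by (auto simp: scale_space_def)
qed

theorem lemma1:
  fixes \<Omega> :: "(real^2) set" and T :: real and D :: "real^2 \<Rightarrow> real^2^2"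
  assumes "bounded_domain \<Omega>" and "T > 0"
    and "cond_H1 \<Omega> T D" and "cond_H2 \<Omega> T D" and "cond_H3 \<Omega> T D"
    and "\<And>(u :: real \<Rightarrow> field2) t x C. \<lbrakk>t \<in> {0<..T}; u t \<in> X1 \<Omega>; x \<in> \<Omega>\<rbrakk>
           \<Longrightarrow> D (u t x + C) = D (u t x)"
  shows "\<forall>u0\<in>X1 \<Omega>. \<forall>C. \<forall>t\<ge>0.
           scale_space \<Omega> D t (\<lambda>_. 0) = X0_class \<Omega> (\<lambda>_. 0) \<and>
           scale_space \<Omega> D t (\<lambda>x. u0 x + C) = class_shift C (scale_space \<Omega> D t u0)"
proof -
  have \<Omega>: "\<Omega> \<in> lmeasurable" using assms(1) by (rule bounded_domain_lmeasurable)
  obtain x0 where x0: "x0 \<in> \<Omega>" using assms(1) by (auto simp: bounded_domain_def)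
  have "(\<lambda>_. 0) \<in> X1 \<Omega>" using has_weak_jacobian_const[OF \<Omega>] X1_iff by blast
  \<comment> \<open>The invariance is instantiated with the zero slice at time \<open>T\<close>, an
    admissible time since it is positive, and with y itself as the constant.\<close>
  then have D0: "D y = D 0" for y
    using assms(6)[of T "\<lambda>_ _. 0" x0 y] \<open>T > 0\<close> x0 by simp
  then have D: "D = (\<lambda>_. D 0)" by blast
  obtain \<alpha> where "\<alpha> > 0" and \<alpha>: "\<And>(u :: real \<Rightarrow> field2) \<xi> x t. x \<in> closure \<Omega> \<Longrightarrow> t \<in> {0..T} \<Longrightarrow>
      \<alpha> * (norm \<xi>)\<^sup>2 \<le> \<xi> \<bullet> (D (u t x) *v \<xi>)"
    using assms(3) unfolding cond_H1_def by blast
  \<comment> \<open>Read as an inequality for the single matrix \<open>D 0\<close>, coercivity no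
    longer refers to \<open>T\<close> and therefore serves every horizon over which
    \<open>scale_space\<close> ranges.\<close>
  have A: "\<alpha> * (norm \<xi>)\<^sup>2 \<le> \<xi> \<bullet> (D 0 *v \<xi>)" for \<xi>
    using \<alpha>[of x0 0 \<xi> "\<lambda>_ _. 0"] x0 \<open>T > 0\<close> closure_subset[of \<Omega>] by auto
  have "scale_space \<Omega> D t (\<lambda>_. 0) = X0_class \<Omega> (\<lambda>_. 0)" if "t \<ge> 0" for t
    by (subst D) (rule scale_space_zero[OF \<Omega> \<open>\<alpha> > 0\<close> A that])
  moreover have "scale_space \<Omega> D t (\<lambda>x. u0 x + C) = class_shift C (scale_space \<Omega> D t u0)" for u0 C t
    by (rule scale_space_shift[OF \<Omega>]) (metis D0)
  ultimately show ?thesis by blast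
qed

end
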